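(* Let $N\ge 3$, let $W_{N+1}$ be the wheel graph with central vertex $c$ and set of rim vertices $V_{\mathrm{rim}}=\{v_1,\ldots,v_N\}$, and for $1\le r\le N$ put $$A_{N,r}=\sum_{\substack{R\subseteq V_{\mathrm{rim}}\\ |R|=r}}\mathcal F_{W_{N+1}}(R),\qquad B_{N,r}=\sum_{\substack{R\subseteq V_{\mathrm{rim}}\\ |R|=r}}\mathcal F_{W_{N+1}}(\{c\}\cup R).$$ Then for every integer $1\le r\le N$, $$A_{N,r}=N[z^{N-r}]\frac{1+z}{(1-z)(1-3z+z^2)^r},\qquad B_{N,r}=\frac{N}{r}[z^{N-r}]\frac{1}{(1-3z+z^2)^r}.$$
   Context: The wheel graph $W_{N+1}$ ($N\ge3$) has vertex set $\{c,v_1,\ldots,v_N\}$ and edges $\{v_i,v_{i+1}\}$ (indices modulo $N$) and $\{c,v_i\}$ for $1\le i\le N$. For a finite connected graph $G$ and $\varnothing\ne S\subseteq V(G)$, a rooted spanning forest of $G$ with root set $S$ is a spanning forest (an acyclic subgraph containing all vertices of $G$) in which each connected component contains exactly one vertex of $S$; $\mathcal F_G(S)$ denotes the number of such forests. For a formal power series $f(z)$, $[z^n]f(z)$ denotes the coefficient of $z^n$ in $f(z)$. *)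

theory Defs
  imports "HOL-Computational_Algebra.Formal_Power_Series"
begin

text \<open>
  Finite simple undirected graphs; an edge is the two-element set of its endpoints.
  (The digraphs of AFP Graph-Theory are not used here: in a symmetric digraph every edge
  already yields a directed cycle, so acyclicity there is not acyclicity of an undirected graph.)
\<close>

record 'a ugraph =
  vertices :: "'a set"
  edges :: "'a set set"

definition simple_graph :: "'a ugraph \<Rightarrow> bool" where
  "simple_graph G \<longleftrightarrow> finite (vertices G) \<and> (\<forall>e\<in>edges G. e \<subseteq> vertices G \<and> card e = 2)"

definition is_subgraph :: "'a ugraph \<Rightarrow> 'a ugraph \<Rightarrow> bool" where
  "is_subgraph H G \<longleftrightarrow>
     simple_graph H \<and> vertices H \<subseteq> vertices G \<and> edges H \<subseteq> edges G"

text \<open>A cycle is given by the cyclic list of its distinct vertices.\<close>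

definition is_cycle :: "'a ugraph \<Rightarrow> 'a list \<Rightarrow> bool" where
  "is_cycle G p \<longleftrightarrow> 3 \<le> length p \<and> distinct p \<and> set p \<subseteq> vertices G \<and>
     (\<forall>i<length p. {p ! i, p ! (Suc i mod length p)} \<in> edges G)"

definition acyclic_graph :: "'a ugraph \<Rightarrow> bool" where
  "acyclic_graph G \<longleftrightarrow> (\<nexists>p. is_cycle G p)"

definition connectivity :: "'a ugraph \<Rightarrow> ('a \<times> 'a) set" where
  "connectivity G =
     {(u, v). u \<in> vertices G \<and> v \<in> vertices G \<and> (u, v) \<in> {(x, y). {x, y} \<in> edges G}\<^sup>*}"

text \<open>The vertex sets of the connected components.\<close>

definition components :: "'a ugraph \<Rightarrow> 'a set set" where
  "components G = vertices G // connectivity G"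

definition connected_graph :: "'a ugraph \<Rightarrow> bool" where
  "connected_graph G \<longleftrightarrow> vertices G \<noteq> {} \<and> (\<forall>u\<in>vertices G. \<forall>v\<in>vertices G. (u, v) \<in> connectivity G)"

definition spanning_forest :: "'a ugraph \<Rightarrow> 'a ugraph \<Rightarrow> bool" where
  "spanning_forest H G \<longleftrightarrow> is_subgraph H G \<and> vertices H = vertices G \<and> acyclic_graph H"

definition rooted_spanning_forest :: "'a ugraph \<Rightarrow> 'a set \<Rightarrow> 'a ugraph \<Rightarrow> bool" where
  "rooted_spanning_forest G S H \<longleftrightarrow>
     spanning_forest H G \<and> (\<forall>C\<in>components H. \<exists>!s. s \<in> S \<and> s \<in> C)"

definition num_rooted_forests :: "'a ugraph \<Rightarrow> 'a set \<Rightarrow> nat" where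
  "num_rooted_forests G S = card {H. rooted_spanning_forest G S H}"

text \<open>
  The rim vertices are indexed by the residues \<open>0, \<dots>, N - 1\<close>, so \<open>Rim 0\<close> plays the role
  of \<open>v\<^sub>N\<close>.  For \<open>N \<ge> 3\<close> this is the wheel on \<open>N + 1\<close> vertices.
\<close>

datatype wheel_vertex = Center | Rim nat

definition rim :: "nat \<Rightarrow> wheel_vertex set" where
  "rim N = Rim ` {..<N}"

definition wheel :: "nat \<Rightarrow> wheel_vertex ugraph" where
  "wheel N =
     \<lparr> vertices = insert Center (rim N),
       edges = {{Rim i, Rim (Suc i mod N)} | i. i < N} \<union> {{Center, Rim i} | i. i < N} \<rparr>"

lemma simple_graph_wheel:
  assumes "3 \<le> N"
  shows "simple_graph (wheel N)"
proof -
  have "Suc i mod N < N" "i \<noteq> Suc i mod N" if "i < N" for i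
    using that assms by (auto simp: mod_Suc)
  then show ?thesis
    by (auto simp: simple_graph_def wheel_def rim_def card_2_iff)
qed

lemma connected_graph_wheel: "connected_graph (wheel N)"
proof -
  let ?R = "{(x, y). {x, y} \<in> edges (wheel N)}"
  have "(u, Center) \<in> ?R\<^sup>*" "(Center, u) \<in> ?R\<^sup>*" if "u \<in> vertices (wheel N)" for u
    using that by (cases "u = Center"; auto simp: wheel_def rim_def insert_commute)+
  then show ?thesis
    unfolding connected_graph_def connectivity_def
    by (auto simp: wheel_def intro: rtrancl_trans)
qed

definition A_sum :: "nat \<Rightarrow> nat \<Rightarrow> nat" where
  "A_sum N r = (\<Sum>R | R \<subseteq> rim N \<and> card R = r. num_rooted_forests (wheel N) R)"

definition B_sum :: "nat \<Rightarrow> nat \<Rightarrow> nat" where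
  "B_sum N r = (\<Sum>R | R \<subseteq> rim N \<and> card R = r. num_rooted_forests (wheel N) ({Center} \<union> R))"

end

theory Submission
  imports Defs
begin

text \<open>
  Orienting every edge of a rooted forest towards the root turns a forest with root set \<open>S\<close> into a
  parent map on the vertices outside \<open>S\<close> all of whose orbits end in \<open>S\<close>.  On the wheel such a map is a
  cyclic word over \<open>Root\<close>, \<open>Hub\<close>, \<open>Lft\<close>, \<open>Rgt\<close> (root, or parent is the centre, the left or the right
  neighbour), and the only obstruction to reaching a root or the centre is a factor \<open>Rgt Lft\<close>; when
  the centre is not a root, its parent must moreover be a rim vertex whose walk along the rim ends
  in a root.  By rotation we may count the words in which a marked root, respectively the root of
  the centre, sits at position \<open>0\<close>.  Linear words avoiding \<open>Rgt Lft\<close> with \<open>s\<close> roots have generating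
  function \<open>1 / (1 - 3z + z\<^sup>2)\<^bsup>s+1\<^esup>\<close> in the number of non-roots; a walk of length \<open>k\<close> to the root, in
  either direction, freezes \<open>k\<close> letters and contributes \<open>z\<^sup>k\<close>, whence the factor
  \<open>1 + 2z / (1 - z) = (1 + z) / (1 - z)\<close>.
\<close>

section \<open>Rooted forests as parent maps\<close>

text \<open>Fixing every point outside \<open>vertices G - S\<close> leaves one function per forest,
  so that forests can be counted by maps; it also keeps an orbit at its root.\<close>

definition parent_maps :: "'a ugraph \<Rightarrow> 'a set \<Rightarrow> ('a \<Rightarrow> 'a) set" where
  "parent_maps G S = {p. (\<forall>v. v \<notin> vertices G - S \<longrightarrow> p v = v) \<and>
     (\<forall>v\<in>vertices G - S. {v, p v} \<in> edges G) \<and> (\<forall>v\<in>vertices G. \<exists>k. (p ^^ k) v \<in> S)}"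

lemma parent_mapsD:
  assumes "p \<in> parent_maps G S"
  shows "v \<notin> vertices G - S \<Longrightarrow> p v = v"
    and "v \<in> vertices G - S \<Longrightarrow> {v, p v} \<in> edges G"
    and "v \<in> vertices G \<Longrightarrow> \<exists>k. (p ^^ k) v \<in> S"
  using assms unfolding parent_maps_def by blast+

definition parent_forest :: "'a ugraph \<Rightarrow> 'a set \<Rightarrow> ('a \<Rightarrow> 'a) \<Rightarrow> 'a ugraph" where
  "parent_forest G S p = \<lparr>vertices = vertices G, edges = (\<lambda>v. {v, p v}) ` (vertices G - S)\<rparr>"

text \<open>For a parent map the \<open>LEAST\<close> exists on all of \<open>vertices G\<close>,
  and this rank drops by one at each step towards the root.\<close>

definition depth :: "'a set \<Rightarrow> ('a \<Rightarrow> 'a) \<Rightarrow> 'a \<Rightarrow> nat" where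
  "depth S p v = (LEAST k. (p ^^ k) v \<in> S)"

text \<open>Prepend the edges one at a time; when the new vertex already lies on the path, keep only
  the part from its occurrence on.\<close>

lemma distinct_path:
  assumes "(x, y) \<in> R\<^sup>*"
  shows "\<exists>xs. xs \<noteq> [] \<and> hd xs = x \<and> last xs = y \<and> distinct xs \<and>
    successively (\<lambda>a b. (a, b) \<in> R) xs"
  using assms
proof (induction rule: converse_rtrancl_induct)
  case base
  show ?case by (rule exI[of _ "[y]"]) auto
next
  case (step x z)
  then obtain xs where xs: "xs \<noteq> []" "hd xs = z" "last xs = y" "distinct xs"
    "successively (\<lambda>a b. (a, b) \<in> R) xs" by blast
  show ?case
  proof (cases "x \<in> set xs")
    case True
    then obtain us vs where "xs = us @ x # vs" by (meson split_list)
    with xs show ?thesis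
      by (intro exI[of _ "x # vs"]) (auto simp: successively_append_iff split: if_splits)
  next
    case False
    with xs step show ?thesis
      by (intro exI[of _ "x # xs"]) (cases xs; auto)
  qed
qed

lemma vertices_parent_forest [simp]: "vertices (parent_forest G S p) = vertices G"
  by (simp add: parent_forest_def)

section \<open>The forest of a parent map\<close>

context
  fixes G :: "'a ugraph" and S :: "'a set" and p :: "'a \<Rightarrow> 'a"
  assumes simple: "simple_graph G" and S: "S \<subseteq> vertices G" and p: "p \<in> parent_maps G S"
begin

lemma parent_in_vertices: "v \<in> vertices G \<Longrightarrow> p v \<in> vertices G"
  using simple p unfolding simple_graph_def parent_maps_def
  by (cases "v \<in> S") (auto, metis DiffI insert_subset)

lemma parent_root: "v \<in> S \<Longrightarrow> p v = v"
  using p unfolding parent_maps_def by auto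

lemma depth_root: "v \<in> S \<Longrightarrow> depth S p v = 0"
  unfolding depth_def by (rule Least_eq_0) simp

lemma funpow_depth: "v \<in> vertices G \<Longrightarrow> (p ^^ depth S p v) v \<in> S"
  using p unfolding depth_def parent_maps_def by (auto intro: LeastI_ex)

lemma depth_parent:
  assumes "v \<in> vertices G" "v \<notin> S"
  shows "depth S p v = Suc (depth S p (p v))"
proof -
  have "(LEAST k. (p ^^ k) v \<in> S) = Suc (LEAST k. (p ^^ Suc k) v \<in> S)"
    by (rule Least_Suc[of "\<lambda>k. (p ^^ k) v \<in> S", OF funpow_depth[OF assms(1)]])
      (use assms in simp)
  then show ?thesis
    unfolding depth_def by (simp add: funpow_swap1)
qed

text \<open>Makes the final root of an orbit an invariant along edges: off \<open>S\<close> the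
  parent continues the same orbit, and a root is fixed.\<close>

lemma root_parent:
  assumes "v \<in> vertices G"
  shows "(p ^^ depth S p (p v)) (p v) = (p ^^ depth S p v) v"
proof (cases "v \<in> S")
  case False
  then show ?thesis using depth_parent[OF assms] by (simp add: funpow_swap1)
qed (simp add: parent_root)

lemma edge_parent_forest:
  "{x, y} \<in> edges (parent_forest G S p) \<longleftrightarrow>
     (x \<in> vertices G - S \<and> y = p x) \<or> (y \<in> vertices G - S \<and> x = p y)"
  unfolding parent_forest_def by (auto simp: doubleton_eq_iff image_iff)

text \<open>At a vertex of maximal depth on a cycle both cyclic neighbours must be its parent, since
  a child would lie deeper. They would coincide, impossible for a cycle of length at least
  3.\<close>

lemma acyclic_parent_forest: "acyclic_graph (parent_forest G S p)"
  unfolding acyclic_graph_def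
proof
  assume "\<exists>c. is_cycle (parent_forest G S p) c"
  then obtain c where c: "3 \<le> length c" "distinct c" "set c \<subseteq> vertices G"
    and e: "\<And>i. i < length c \<Longrightarrow> {c ! i, c ! (Suc i mod length c)} \<in> edges (parent_forest G S p)"
    unfolding is_cycle_def by auto
  let ?n = "length c"
  have "set c \<noteq> {}" using c by auto
  then obtain v where v: "v \<in> set c" and vmax: "\<And>u. u \<in> set c \<Longrightarrow> depth S p u \<le> depth S p v"
    using obtains_MAX[of "set c" "depth S p"] by (metis Max_ge finite_imageI finite_set image_eqI)
  from v obtain i where i: "i < ?n" "c ! i = v" by (auto simp: in_set_conv_nth)
  \<comment> \<open>\<open>j\<close> is the cyclic predecessor of \<open>i\<close>.\<close>
  define j where "j = (if i = 0 then ?n - 1 else i - 1)"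
  have j: "j < ?n" "Suc j mod ?n = i"
    using i c by (auto simp: j_def)
  have nb: "u = p v" if "{v, u} \<in> edges (parent_forest G S p)" "u \<in> set c" for u
    using that vmax[of u] depth_parent[of u] by (auto simp: edge_parent_forest)
  have "c ! j = p v" using e[OF j(1)] j i by (intro nb) (auto simp: insert_commute)
  moreover have i': "Suc i mod ?n < ?n" using c(1) by (intro mod_less_divisor) linarith
  then have "c ! (Suc i mod ?n) = p v" using e[OF i(1)] i by (intro nb nth_mem) auto
  ultimately have "j = Suc i mod ?n"
    using c(2) j(1) i' by (metis nth_eq_iff_index_eq)
  moreover have "j \<noteq> Suc i mod ?n"
    using j i c by (auto simp: mod_Suc split: if_splits)
  ultimately show False by simp
qed

lemma funpow_in_vertices: "v \<in> vertices G \<Longrightarrow> (p ^^ k) v \<in> vertices G"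
  by (induction k) (auto intro: parent_in_vertices)

lemma funpow_connected:
  assumes "v \<in> vertices G"
  shows "(v, (p ^^ k) v) \<in> {(x, y). {x, y} \<in> edges (parent_forest G S p)}\<^sup>*"
proof (induction k)
  case (Suc k)
  show ?case
  proof (cases "(p ^^ k) v \<in> S")
    case True
    then show ?thesis using Suc by (simp add: parent_root)
  next
    case False
    then have "((p ^^ k) v, (p ^^ Suc k) v) \<in> {(x, y). {x, y} \<in> edges (parent_forest G S p)}"
      using funpow_in_vertices[OF assms] by (simp add: edge_parent_forest)
    then show ?thesis using Suc by (rule rtrancl_into_rtrancl[rotated])
  qed
qed simp

lemma root_connected:
  assumes "(x, y) \<in> {(x, y). {x, y} \<in> edges (parent_forest G S p)}\<^sup>*"
  shows "(p ^^ depth S p x) x = (p ^^ depth S p y) y"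
  using assms by (induction) (auto simp: edge_parent_forest root_parent)

text \<open>In the component of \<open>v\<close> the end of its orbit is a root, and any root there
  is the end of its own orbit, hence the same one by \<open>root_connected\<close>.\<close>

lemma rooted_parent_forest: "rooted_spanning_forest G S (parent_forest G S p)"
proof -
  have "\<exists>!s. s \<in> S \<and> s \<in> C" if "C \<in> components (parent_forest G S p)" for C
  proof -
    from that obtain v where v: "v \<in> vertices G"
      and C: "C = connectivity (parent_forest G S p) `` {v}"
      unfolding components_def quotient_def by auto
    show ?thesis
    proof (intro ex1I conjI)
      show "(p ^^ depth S p v) v \<in> S" by (rule funpow_depth[OF v])
      show "(p ^^ depth S p v) v \<in> C"
        using v funpow_connected funpow_in_vertices by (simp add: C connectivity_def)
      fix s assume s: "s \<in> S \<and> s \<in> C"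
      then have "(p ^^ depth S p v) v = (p ^^ depth S p s) s"
        by (intro root_connected) (auto simp: C connectivity_def)
      then show "s = (p ^^ depth S p v) v" using s by (simp add: depth_root)
    qed
  qed
  moreover have "simple_graph (parent_forest G S p)" "edges (parent_forest G S p) \<subseteq> edges G"
    using simple p parent_in_vertices
    unfolding simple_graph_def parent_maps_def parent_forest_def by fastforce+
  ultimately show ?thesis
    unfolding rooted_spanning_forest_def spanning_forest_def is_subgraph_def
    using acyclic_parent_forest by simp
qed

end

text \<open>Induction on depth. If \<open>p\<close> and \<open>q\<close> disagree at
  \<open>v\<close>, the edge \<open>{v, p v}\<close> occurs in the forest of \<open>q\<close> only
  as the parent edge of \<open>p v\<close>, so \<open>q (p v) = v\<close>. The induction hypothesis
  at the less deep \<open>p v\<close> gives \<open>p (p v) = v\<close>, contradicting the drop in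
  depth.\<close>

lemma inj_on_parent_forest:
  assumes G: "simple_graph G" "S \<subseteq> vertices G"
  shows "inj_on (parent_forest G S) (parent_maps G S)"
proof (rule inj_onI, rule ext)
  fix p q v
  assume p: "p \<in> parent_maps G S" and q: "q \<in> parent_maps G S"
    and eq: "parent_forest G S p = parent_forest G S q"
  show "p v = q v"
  proof (induction "depth S p v" arbitrary: v rule: less_induct)
    case less
    show ?case
    proof (rule ccontr)
      assume ne: "p v \<noteq> q v"
      then have v: "v \<in> vertices G" "v \<notin> S"
        using parent_mapsD(1)[OF p, of v] parent_mapsD(1)[OF q, of v] by fastforce+
      then have "{v, p v} \<in> edges (parent_forest G S q)"
        using edge_parent_forest[OF G p, of v "p v"] eq by simp
      with ne have qv: "p v \<in> vertices G" "p v \<notin> S" "q (p v) = v"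
        by (auto simp: edge_parent_forest[OF G q])
      have "depth S p (p v) < depth S p v" using depth_parent[OF G p v] by simp
      then have "p (p v) = v" using less qv by simp
      then show False using depth_parent[OF G p v] depth_parent[OF G p qv(1,2)] by simp
    qed
  qed
qed

text \<open>Let each non-root point to a neighbour closer to \<open>S\<close>. These edges lie in
  \<open>H\<close>; any further edge of \<open>H\<close> would close the path between its ends
  through their common root to a cycle.\<close>

lemma rooted_forest_is_parent_forest:
  assumes G: "simple_graph G" "S \<subseteq> vertices G" and H: "rooted_spanning_forest G S H"
  shows "\<exists>p\<in>parent_maps G S. parent_forest G S p = H"
proof -
  let ?R = "{(x, y). {x, y} \<in> edges H}"
  have V: "vertices H = vertices G" and sub: "edges H \<subseteq> edges G" and simpH: "simple_graph H"
    and acyc: "acyclic_graph H"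
    using H by (auto simp: rooted_spanning_forest_def spanning_forest_def is_subgraph_def)
  have root: "\<exists>!s. s \<in> S \<and> (v, s) \<in> ?R\<^sup>*" if "v \<in> vertices G" for v
  proof -
    have "connectivity H `` {v} \<in> components H"
      using that V by (auto simp: components_def intro: quotientI)
    then have "\<exists>!s. s \<in> S \<and> s \<in> connectivity H `` {v}"
      using H unfolding rooted_spanning_forest_def by blast
    moreover have "s \<in> S \<and> s \<in> connectivity H `` {v} \<longleftrightarrow> s \<in> S \<and> (v, s) \<in> ?R\<^sup>*" for s
      using that V G by (auto simp: connectivity_def)
    ultimately show ?thesis by simp
  qed
  \<comment> \<open>Distance to \<open>S\<close> in \<open>H\<close>; its strict decrease along
    \<open>f\<close> makes every orbit reach \<open>S\<close>.\<close>
  define d where "d v = (LEAST n. \<exists>s\<in>S. (v, s) \<in> ?R ^^ n)" for v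
  have "\<exists>u. {v, u} \<in> edges H \<and> d u < d v" if v: "v \<in> vertices G" "v \<notin> S" for v
  proof -
    from root[OF v(1)] obtain s where "s \<in> S" "(v, s) \<in> ?R\<^sup>*" by blast
    then have "\<exists>n. \<exists>s\<in>S. (v, s) \<in> ?R ^^ n" using rtrancl_imp_relpow by blast
    then have "\<exists>s\<in>S. (v, s) \<in> ?R ^^ d v" unfolding d_def by (rule LeastI_ex)
    then obtain s where s: "s \<in> S" "(v, s) \<in> ?R ^^ d v" by auto
    show ?thesis
    proof (cases "d v")
      case 0
      then show ?thesis using s v by simp
    next
      case (Suc m)
      then obtain u where u: "(v, u) \<in> ?R" "(u, s) \<in> ?R ^^ m" using s(2) by (metis relpow_Suc_D2)
      then have "d u \<le> m" unfolding d_def using s(1) by (intro Least_le) auto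
      then show ?thesis using u Suc by auto
    qed
  qed
  then obtain f where f: "{v, f v} \<in> edges H \<and> d (f v) < d v"
    if "v \<in> vertices G" "v \<notin> S" for v by metis
  define p where "p v = (if v \<in> vertices G - S then f v else v)" for v
  have pe: "{v, p v} \<in> edges H" if "v \<in> vertices G" "v \<notin> S" for v
    using f that by (simp add: p_def)
  have pV: "p v \<in> vertices G" if "v \<in> vertices G" "v \<notin> S" for v
    using pe[OF that] simpH V by (auto simp: simple_graph_def)
  have reach: "\<exists>k. (p ^^ k) v \<in> S" if "v \<in> vertices G" for v
    using that
  proof (induction "d v" arbitrary: v rule: less_induct)
    case less
    show ?case
    proof (cases "v \<in> S")
      case True
      then show ?thesis by (intro exI[of _ 0]) simp
    next
      case False
      then have "d (p v) < d v" using f less by (simp add: p_def)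
      then obtain k where "(p ^^ k) (p v) \<in> S" using less pV False by blast
      then show ?thesis by (intro exI[of _ "Suc k"]) (simp add: funpow_swap1)
    qed
  qed
  have p: "p \<in> parent_maps G S"
    unfolding parent_maps_def using reach pe sub by (auto simp: p_def)
  let ?F = "parent_forest G S p"
  let ?Q = "{(x, y). {x, y} \<in> edges ?F}"
  have FH: "edges ?F \<subseteq> edges H" using pe by (auto simp: parent_forest_def)
  have symQ: "sym (?Q\<^sup>*)" by (intro sym_rtrancl symI) (auto simp: insert_commute)
  have QR: "?Q\<^sup>* \<subseteq> ?R\<^sup>*" using FH by (intro rtrancl_mono) auto
  have "edges H \<subseteq> edges ?F"
  proof
    fix e assume e: "e \<in> edges H"
    then obtain x y where xy: "e = {x, y}" "x \<noteq> y" "x \<in> vertices G" "y \<in> vertices G"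
      using simpH V by (metis card_2_iff insert_subset simple_graph_def)
    let ?s = "(p ^^ depth S p x) x" and ?t = "(p ^^ depth S p y) y"
    have xs: "(x, ?s) \<in> ?Q\<^sup>*" and yt: "(y, ?t) \<in> ?Q\<^sup>*"
      by (rule funpow_connected[OF G p], use xy in simp)+
    \<comment> \<open>Both orbits end in \<open>S\<close> within one component of \<open>H\<close>,
      which has only one root.\<close>
    have "?s \<in> S" "?t \<in> S" using funpow_depth[OF G p] xy by auto
    moreover have "(x, ?t) \<in> ?R\<^sup>*"
      using QR yt e xy by (intro converse_rtrancl_into_rtrancl[of x y]) auto
    ultimately have st: "?s = ?t" using root[OF xy(3)] xs QR by blast
    have "(?s, y) \<in> ?Q\<^sup>*" unfolding st by (rule symD[OF symQ yt])
    \<comment> \<open>Joining the two orbits at their root and shortening gives a simple path from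
      \<open>x\<close> to \<open>y\<close> inside \<open>?F\<close>.\<close>
    from distinct_path[OF rtrancl_trans[OF xs this]] obtain c
      where c: "c \<noteq> []" "hd c = x" "last c = y" "distinct c"
      and suc: "successively (\<lambda>a b. (a, b) \<in> ?Q) c" by blast
    show "e \<in> edges ?F"
    proof (rule ccontr)
      assume ne: "e \<notin> edges ?F"
      \<comment> \<open>One vertex would mean \<open>x = y\<close>, two would put \<open>e\<close>
        into \<open>?F\<close>.\<close>
      have len: "3 \<le> length c"
      proof (rule ccontr)
        assume "\<not> 3 \<le> length c"
        then have "(\<exists>a. c = [a]) \<or> (\<exists>a b. c = [a, b])" using c(1)
          by (cases c rule: remdups_adj.cases) (auto simp: numeral_3_eq_3 not_less_eq_eq)
        then show False using c suc ne xy by auto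
      qed
      \<comment> \<open>All edges of the cycle come from the path except the closing one, which is
        \<open>e\<close>.\<close>
      have ed: "{c ! i, c ! (Suc i mod length c)} \<in> edges H" if "i < length c" for i
      proof (cases "Suc i < length c")
        case True
        then show ?thesis using suc FH by (auto simp: successively_conv_nth)
      next
        case False
        then have "i = length c - 1" "Suc i = length c" using that by auto
        then show ?thesis using c e xy by (simp add: hd_conv_nth last_conv_nth insert_commute)
      qed
      have "set c \<subseteq> vertices H"
        using ed simpH by (fastforce simp: simple_graph_def in_set_conv_nth)
      then have "is_cycle H c" using len ed c by (simp add: is_cycle_def)
      then show False using acyc by (auto simp: acyclic_graph_def)
    qed
  qed
  with FH have "?F = H" using V by (simp add: parent_forest_def)
  with p show ?thesis by blast
qed

lemma num_rooted_forests_eq_card_parent_maps: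
  assumes G: "simple_graph G" "S \<subseteq> vertices G"
  shows "num_rooted_forests G S = card (parent_maps G S)"
proof -
  have "{H. rooted_spanning_forest G S H} = parent_forest G S ` parent_maps G S"
    using rooted_forest_is_parent_forest[OF G] rooted_parent_forest[OF G] by force
  then show ?thesis
    unfolding num_rooted_forests_def using inj_on_parent_forest[OF G] by (simp add: card_image)
qed

section \<open>Linear words\<close>

datatype letter = Root | Hub | Lft | Rgt

abbreviation compatible :: "letter \<Rightarrow> letter \<Rightarrow> bool" where
  "compatible a b \<equiv> \<not> (a = Rgt \<and> b = Lft)"

text \<open>The size \<open>m\<close> counts the non-roots rather than the length because it is the
  exponent of \<open>z\<close> in the generating function.\<close>

definition strings :: "nat \<Rightarrow> nat \<Rightarrow> letter list set" where
  "strings m s = {xs. successively compatible xs \<and>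
     length (filter (\<lambda>a. a = Root) xs) = s \<and> length (filter (\<lambda>a. a \<noteq> Root) xs) = m}"

lemma length_strings: "xs \<in> strings m s \<Longrightarrow> length xs = m + s"
  using sum_length_filter_compl[of "\<lambda>a. a = Root" xs] by (auto simp: strings_def)

lemma finite_letter: "finite (UNIV :: letter set)"
proof -
  have "(UNIV :: letter set) = {Root, Hub, Lft, Rgt}"
    using letter.exhaust by auto
  then show ?thesis by (metis finite.simps)
qed

lemma finite_strings [simp]: "finite (strings m s)"
  by (rule finite_subset[OF _ finite_lists_length_eq[OF finite_letter, of "m + s"]])
    (auto dest: length_strings)

lemma strings_Cons:
  "Root # xs \<in> strings m s \<longleftrightarrow> s > 0 \<and> xs \<in> strings m (s - 1)"
  "Hub # xs \<in> strings m s \<longleftrightarrow> m > 0 \<and> xs \<in> strings (m - 1) s"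
  "Lft # xs \<in> strings m s \<longleftrightarrow> m > 0 \<and> xs \<in> strings (m - 1) s"
  "Rgt # xs \<in> strings m s \<longleftrightarrow> m > 0 \<and> xs \<in> strings (m - 1) s \<and> (\<forall>ys. xs \<noteq> Lft # ys)"
  by (cases xs; auto simp: strings_def)+

lemma strings_Nil: "[] \<in> strings m s \<longleftrightarrow> m = 0 \<and> s = 0"
  by (auto simp: strings_def)

lemma strings_0: "strings 0 s = (if s = 0 then {[]} else (#) Root ` strings 0 (s - 1))"
proof (rule set_eqI)
  fix xs show "xs \<in> strings 0 s \<longleftrightarrow> xs \<in> (if s = 0 then {[]} else (#) Root ` strings 0 (s - 1))"
    by (cases xs; cases "hd xs") (auto simp: strings_Nil strings_Cons)
qed

text \<open>Split by the first letter. Only \<open>Rgt\<close> restricts its tail: those starting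
  with \<open>Lft\<close> are removed.\<close>

lemma strings_Suc:
  "strings (Suc m) s = (if s = 0 then {} else (#) Root ` strings (Suc m) (s - 1)) \<union>
     (#) Hub ` strings m s \<union> (#) Lft ` strings m s \<union>
     (#) Rgt ` (strings m s - (if m = 0 then {} else (#) Lft ` strings (m - 1) s))" (is "_ = ?B")
proof (rule set_eqI)
  fix xs show "xs \<in> strings (Suc m) s \<longleftrightarrow> xs \<in> ?B"
    by (cases xs; cases "hd xs") (auto simp: strings_Nil strings_Cons)
qed

text \<open>The removed tails stand on the left, so no truncated subtraction occurs. The recurrence
  says that multiplying the series by \<open>1 - 3z + z^2\<close> lowers \<open>s\<close> by
  one.\<close>

lemma card_strings_Suc:
  "card (strings (Suc m) s) + (if m = 0 then 0 else card (strings (m - 1) s)) =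
     (if s = 0 then 0 else card (strings (Suc m) (s - 1))) + 3 * card (strings m s)"
proof -
  let ?D = "if m = 0 then {} else (#) Lft ` strings (m - 1) s"
  have D: "?D \<subseteq> strings m s" by (auto simp: strings_Cons)
  have "card ?D = (if m = 0 then 0 else card (strings (m - 1) s))"
    by (auto simp: card_image)
  moreover have "card ?D \<le> card (strings m s)" using D by (intro card_mono) auto
  moreover have "card (strings m s - ?D) = card (strings m s) - card ?D"
    using D by (intro card_Diff_subset) auto
  moreover have "card (strings (Suc m) s) =
      card (if s = 0 then {} else (#) Root ` strings (Suc m) (s - 1)) +
      card ((#) Hub ` strings m s) + card ((#) Lft ` strings m s) +
      card ((#) Rgt ` (strings m s - ?D))"
  proof -
    let ?A = "if s = 0 then {} else (#) Root ` strings (Suc m) (s - 1)"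
    let ?E = "strings m s - ?D"
    have fin: "finite ?A" "finite ?E" by auto
    have "card (?A \<union> (#) Hub ` strings m s) = card ?A + card ((#) Hub ` strings m s)"
      using fin by (intro card_Un_disjoint) auto
    moreover have "card (?A \<union> (#) Hub ` strings m s \<union> (#) Lft ` strings m s) =
        card (?A \<union> (#) Hub ` strings m s) + card ((#) Lft ` strings m s)"
      using fin by (intro card_Un_disjoint) auto
    moreover have "card (?A \<union> (#) Hub ` strings m s \<union> (#) Lft ` strings m s \<union> (#) Rgt ` ?E) =
        card (?A \<union> (#) Hub ` strings m s \<union> (#) Lft ` strings m s) + card ((#) Rgt ` ?E)"
      using fin by (intro card_Un_disjoint) auto
    ultimately show ?thesis unfolding strings_Suc[of m s] by linarith
  qed
  moreover have "card ((#) Hub ` strings m s) = card (strings m s)"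
    "card ((#) Lft ` strings m s) = card (strings m s)"
    "card ((#) Rgt ` (strings m s - ?D)) = card (strings m s - ?D)"
    by (intro card_image; simp)+
  moreover have "card (if s = 0 then {} else (#) Root ` strings (Suc m) (s - 1)) =
      (if s = 0 then 0 else card (strings (Suc m) (s - 1)))"
    by (auto simp: card_image)
  ultimately show ?thesis by linarith
qed

text \<open>The recurrence reads \<open>?D * ?G s = ?G (s - 1)\<close> for positive
  \<open>s\<close>, and \<open>?D * ?G 0 = 1\<close>; one factor \<open>?D\<close> per root and one
  more give \<open>?D ^ Suc s * ?G s = 1\<close>.\<close>

lemma string_series:
  "Abs_fps (\<lambda>m. real (card (strings m s))) = inverse ((1 - 3 * fps_X + fps_X ^ 2) ^ Suc s)"
proof -
  let ?D = "1 - 3 * fps_X + fps_X ^ 2 :: real fps"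
  let ?G = "\<lambda>s. Abs_fps (\<lambda>m. real (card (strings m s)))"
  have DG: "?D * ?G s = (if s = 0 then 1 else ?G (s - 1))" for s
  proof (rule fps_ext)
    fix n
    have expand: "?D * ?G s = ?G s - 3 * (fps_X * ?G s) + fps_X * (fps_X * ?G s)"
      by (simp add: algebra_simps power2_eq_square)
    have three: "fps_nth (3 * f) k = 3 * fps_nth f k" for f :: "real fps" and k
      by (simp add: numeral_fps_const)
    have c: "real (card (strings (Suc m) s)) = 3 * real (card (strings m s))
        - (if m = 0 then 0 else real (card (strings (m - 1) s)))
        + (if s = 0 then 0 else real (card (strings (Suc m) (s - 1))))" for m
      using card_strings_Suc[of m s] by (simp split: if_splits)
    show "fps_nth (?D * ?G s) n = fps_nth (if s = 0 then 1 else ?G (s - 1)) n"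
    proof (cases n)
      case 0
      then show ?thesis unfolding expand by (simp add: strings_0[of s] card_image three)
    next
      case (Suc m)
      then show ?thesis unfolding expand
        by (cases m) (auto simp: three c)
    qed
  qed
  have "?D ^ Suc s * ?G s = 1"
  proof (induction s)
    case (Suc s)
    have "?D ^ Suc (Suc s) * ?G (Suc s) = ?D ^ Suc s * (?D * ?G (Suc s))"
      by (subst power_Suc2) (rule mult.assoc)
    also have "\<dots> = ?D ^ Suc s * ?G s" by (simp only: DG) simp
    finally show ?case by (simp only: Suc.IH)
  next
    case 0
    show ?case using DG[of 0] by simp
  qed
  then show ?thesis by (rule fps_inverse_unique[symmetric])
qed

section \<open>Coefficients of the two rational series\<close>

lemma kernel_nth_0: "fps_nth ((1 - 3 * fps_X + fps_X ^ 2 :: real fps) ^ n) 0 = 1"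
  by (simp add: fps_nth_power_0)

lemma coeff_B:
  "fps_nth (1 / (1 - 3 * fps_X + fps_X ^ 2) ^ Suc s) m = real (card (strings m s))"
proof -
  have "1 / (1 - 3 * fps_X + fps_X ^ 2 :: real fps) ^ Suc s =
      Abs_fps (\<lambda>m. real (card (strings m s)))"
    unfolding string_series
    by (subst fps_divide_unit)
      (simp_all only: kernel_nth_0 mult_1_left one_neq_zero not_False_eq_True)
  then show ?thesis by (simp only: fps_nth_Abs_fps)
qed

text \<open>As \<open>(1 + z) / (1 - z) = 1 + 2z + 2z^2 + ...\<close>, the coefficient is a
  convolution of the string counts with the weights 1, 2, 2, and so on.\<close>

lemma coeff_A:
  "fps_nth ((1 + fps_X) / ((1 - fps_X) * (1 - 3 * fps_X + fps_X ^ 2) ^ Suc s)) m =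
     real (card (strings m s)) + 2 * (\<Sum>k = 1..m. real (card (strings (m - k) s)))"
proof -
  define D where "D = (1 - 3 * fps_X + fps_X ^ 2 :: real fps) ^ Suc s"
  have D0: "fps_nth D 0 = 1" unfolding D_def by (rule kernel_nth_0)
  let ?g = "Abs_fps (\<lambda>n::nat. if n = 0 then 1 else 2 :: real)"
  have g: "(1 - fps_X) * ?g = 1 + fps_X"
  proof (rule fps_ext)
    fix n show "fps_nth ((1 - fps_X) * ?g) n = fps_nth (1 + fps_X) n"
      by (cases n) (auto simp: left_diff_distrib)
  qed
  have "(1 + fps_X) / ((1 - fps_X) * D) = ((1 - fps_X) * ?g) * inverse ((1 - fps_X) * D)"
    unfolding g by (rule fps_divide_unit) (simp add: D0)
  also have "\<dots> = ?g * (inverse (1 - fps_X) * (1 - fps_X)) * inverse D"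
    by (simp only: fps_inverse_mult mult_ac)
  also have "\<dots> = ?g * inverse D"
    by (subst inverse_mult_eq_1) simp_all
  also have "inverse D = Abs_fps (\<lambda>m. real (card (strings m s)))"
    unfolding D_def string_series ..
  finally have "fps_nth ((1 + fps_X) / ((1 - fps_X) * D)) m =
      (\<Sum>k = 0..m. (if k = 0 then 1 else 2) * real (card (strings (m - k) s)))"
    by (simp only: fps_mult_nth fps_nth_Abs_fps)
  also have "\<dots> = real (card (strings m s)) + (\<Sum>k = 1..m. 2 * real (card (strings (m - k) s)))"
    by (subst sum.atLeast_Suc_atMost) (auto intro!: sum.cong)
  finally show ?thesis by (simp only: D_def sum_distrib_left)
qed

section \<open>Parent maps of the wheel as cyclic words\<close>

definition rim_at :: "nat \<Rightarrow> int \<Rightarrow> wheel_vertex" where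
  "rim_at N i = Rim (nat (i mod int N))"

text \<open>
  Cyclic words are represented as periodic functions on \<open>int\<close>, so that rotation and reflection act
  by substitution in the argument and no index wraps around.
\<close>

definition periodic :: "nat \<Rightarrow> (int \<Rightarrow> letter) \<Rightarrow> bool" where
  "periodic N w \<longleftrightarrow> (\<forall>i. w (i mod int N) = w i)"

text \<open>Roots are counted over one period, while compatibility over all of \<open>int\<close>
  includes the passage from \<open>N - 1\<close> to \<open>0\<close>.\<close>

definition words :: "nat \<Rightarrow> nat \<Rightarrow> (int \<Rightarrow> letter) set" where
  "words N r = {w. periodic N w \<and> card {i \<in> {0..<int N}. w i = Root} = r \<and>
     (\<forall>i. compatible (w i) (w (i + 1)))}"

definition root_set :: "nat \<Rightarrow> (int \<Rightarrow> letter) \<Rightarrow> wheel_vertex set" where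
  "root_set N w = rim_at N ` {i. w i = Root}"

text \<open>\<open>c\<close> is the parent of the centre, and is \<open>Center\<close> itself when
  the centre is a root. Indices from \<open>N\<close> on name no vertex and are fixed, as
  \<open>parent_maps\<close> demands.\<close>

definition word_parent :: "nat \<Rightarrow> (int \<Rightarrow> letter) \<Rightarrow> wheel_vertex \<Rightarrow> wheel_vertex \<Rightarrow> wheel_vertex" where
  "word_parent N w c v = (case v of Center \<Rightarrow> c | Rim i \<Rightarrow>
     if i < N then (case w (int i) of Root \<Rightarrow> Rim i | Hub \<Rightarrow> Center
       | Lft \<Rightarrow> rim_at N (int i - 1) | Rgt \<Rightarrow> rim_at N (int i + 1)) else Rim i)"

text \<open>Meant for \<open>y = Root\<close> and \<open>y = Hub\<close>, where the walk along the rim stops; \<open>\<sigma>\<close> is its direction.\<close>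

definition leads :: "(int \<Rightarrow> letter) \<Rightarrow> letter \<Rightarrow> int \<Rightarrow> bool" where
  "leads w y i \<longleftrightarrow> (\<exists>(x, \<sigma>) \<in> {(Lft, -1), (Rgt, 1)}. \<exists>k. w (i + \<sigma> * int k) = y \<and>
     (\<forall>l<k. w (i + \<sigma> * int l) = x))"

section \<open>Neighbours and walks on the wheel in integer coordinates\<close>

context
  fixes N :: nat
  assumes N: "3 \<le> N"
begin

lemma rim_at_eq_iff: "rim_at N i = rim_at N j \<longleftrightarrow> i mod int N = j mod int N"
  using N by (simp add: rim_at_def eq_nat_nat_iff)

lemma rim_at_mod [simp]: "rim_at N (i mod int N) = rim_at N i"
  by (simp add: rim_at_eq_iff)

lemma rim_at_mod_add [simp]: "rim_at N (i mod int N + 1) = rim_at N (i + 1)"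
  and rim_at_mod_diff [simp]: "rim_at N (i mod int N - 1) = rim_at N (i - 1)"
  by (simp_all add: rim_at_eq_iff mod_simps)

lemma rim_at_neq [simp]: "rim_at N i \<noteq> Center" "Center \<noteq> rim_at N i"
  by (simp_all add: rim_at_def)

lemma rim_at_int: "i < N \<Longrightarrow> rim_at N (int i) = Rim i"
  by (simp add: rim_at_def)

lemma rim_eq: "rim N = range (rim_at N)"
proof (intro equalityI subsetI)
  fix v assume "v \<in> rim N"
  then show "v \<in> range (rim_at N)" by (auto simp: rim_def simp flip: rim_at_int)
next
  fix v assume "v \<in> range (rim_at N)"
  then show "v \<in> rim N" using N by (auto simp: rim_def rim_at_def nat_less_iff)
qed

lemma rim_at_in_rim [simp]: "rim_at N i \<in> rim N"
  by (simp add: rim_eq)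

text \<open>Neither 1 nor 2 is divisible by \<open>N\<close>, because \<open>N \<ge> 3\<close>; this
  tells \<open>Lft\<close> from \<open>Rgt\<close>.\<close>

lemma rim_at_neq_neighbours:
  "rim_at N (i + 1) \<noteq> rim_at N i" "rim_at N (i - 1) \<noteq> rim_at N i" "rim_at N (i + 1) \<noteq> rim_at N (i - 1)"
  using N by (auto simp: rim_at_eq_iff mod_eq_dvd_iff zdvd_not_zless)

lemma wheel_edges:
  "edges (wheel N) = range (\<lambda>i. {rim_at N i, rim_at N (i + 1)}) \<union> range (\<lambda>i. {Center, rim_at N i})"
proof -
  \<comment> \<open>A family over the indices below \<open>N\<close> and its periodic extension to
    \<open>int\<close> have the same members.\<close>
  have *: "{f i |i. i < N} = range g" if g: "\<And>i. i < N \<Longrightarrow> f i = g (int i)"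
    and gm: "\<And>i. g (i mod int N) = g i" for f :: "nat \<Rightarrow> wheel_vertex set" and g
  proof (intro equalityI subsetI)
    fix e assume "e \<in> range g"
    then obtain i where "e = g i" by blast
    then have "e = f (nat (i mod int N))" "nat (i mod int N) < N"
      using N by (auto simp: nat_less_iff g gm)
    then show "e \<in> {f i |i. i < N}" by blast
  qed (use g in auto)
  have "{{Rim i, Rim (Suc i mod N)} |i. i < N} = range (\<lambda>i. {rim_at N i, rim_at N (i + 1)})"
  proof (rule *)
    show "{Rim i, Rim (Suc i mod N)} = {rim_at N (int i), rim_at N (int i + 1)}" if "i < N" for i
      using that by (simp add: rim_at_int) (simp add: rim_at_def nat_mod_distrib nat_add_distrib)
    show "{rim_at N (i mod int N), rim_at N (i mod int N + 1)} = {rim_at N i, rim_at N (i + 1)}" for i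
      by simp
  qed
  moreover have "{{Center, Rim i} |i. i < N} = range (\<lambda>i. {Center, rim_at N i})"
    by (rule *) (simp_all add: rim_at_int)
  ultimately show ?thesis by (simp add: wheel_def)
qed

lemma wheel_vertices: "vertices (wheel N) = insert Center (rim N)"
  by (simp add: wheel_def)

lemma rim_at_edge:
  "{rim_at N i, u} \<in> edges (wheel N) \<longleftrightarrow> u = Center \<or> u = rim_at N (i - 1) \<or> u = rim_at N (i + 1)"
proof
  assume "{rim_at N i, u} \<in> edges (wheel N)"
  then consider j where "{rim_at N i, u} = {rim_at N j, rim_at N (j + 1)}" | j where "{rim_at N i, u} = {Center, rim_at N j}"
    unfolding wheel_edges by blast
  then show "u = Center \<or> u = rim_at N (i - 1) \<or> u = rim_at N (i + 1)"
  proof cases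
    case 1
    then consider "rim_at N i = rim_at N j" "u = rim_at N (j + 1)" | "rim_at N i = rim_at N (j + 1)" "u = rim_at N j"
      by (metis doubleton_eq_iff)
    then show ?thesis
    proof cases
      case 1
      then show ?thesis using mod_add_cong[of i "int N" j 1 1] by (simp add: rim_at_eq_iff)
    next
      case 2
      then show ?thesis using mod_diff_cong[of i "int N" "j + 1" 1 1] by (simp add: rim_at_eq_iff)
    qed
  next
    case 2
    then have "u = Center" by (metis doubleton_eq_iff rim_at_neq(1))
    then show ?thesis ..
  qed
next
  have "{rim_at N i, rim_at N (i - 1)} = {rim_at N (i - 1), rim_at N (i - 1 + 1)}" by auto
  then have "{rim_at N i, rim_at N (i - 1)} \<in> edges (wheel N)" unfolding wheel_edges by blast
  then show "u = Center \<or> u = rim_at N (i - 1) \<or> u = rim_at N (i + 1) \<Longrightarrow> {rim_at N i, u} \<in> edges (wheel N)"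
    by (auto simp: wheel_edges)
qed

lemma center_edge: "{Center, u} \<in> edges (wheel N) \<longleftrightarrow> u \<in> rim N"
  by (auto simp: wheel_edges doubleton_eq_iff rim_eq)

lemma periodic_eq: "periodic N w \<Longrightarrow> i mod int N = j mod int N \<Longrightarrow> w i = w j"
  unfolding periodic_def by metis

lemma word_parent_center [simp]: "word_parent N w c Center = c"
  by (simp add: word_parent_def)

lemma word_parent_rim_at:
  assumes "periodic N w"
  shows "word_parent N w c (rim_at N i) = (case w i of Root \<Rightarrow> rim_at N i | Hub \<Rightarrow> Center
       | Lft \<Rightarrow> rim_at N (i - 1) | Rgt \<Rightarrow> rim_at N (i + 1))"
proof -
  have "nat (i mod int N) < N" "int (nat (i mod int N)) = i mod int N"
    using N by (auto simp: nat_less_iff)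
  moreover have "w (i mod int N) = w i" using assms by (simp add: periodic_def)
  moreover have "rim_at N i = Rim (nat (i mod int N))" by (simp add: rim_at_def)
  ultimately show ?thesis by (simp add: word_parent_def split: letter.split)
qed

lemma word_parent_outside: "v \<notin> vertices (wheel N) \<Longrightarrow> word_parent N w c v = v"
  by (cases v) (auto simp: word_parent_def wheel_def rim_def)

lemma rim_at_in_root_set: "periodic N w \<Longrightarrow> rim_at N i \<in> root_set N w \<longleftrightarrow> w i = Root"
  by (auto simp: root_set_def rim_at_eq_iff) (metis periodic_eq)

lemma root_set_subset: "root_set N w \<subseteq> rim N"
  by (auto simp: root_set_def)

lemma card_root_set:
  assumes "periodic N w"
  shows "card (root_set N w) = card {i \<in> {0..<int N}. w i = Root}"
proof -
  have "root_set N w = rim_at N ` {i \<in> {0..<int N}. w i = Root}"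
  proof (intro equalityI subsetI)
    fix v assume "v \<in> root_set N w"
    then obtain i where "v = rim_at N (i mod int N)" "w (i mod int N) = Root"
      using assms by (auto simp: root_set_def periodic_def)
    moreover have "i mod int N \<in> {0..<int N}" using N by simp
    ultimately show "v \<in> rim_at N ` {i \<in> {0..<int N}. w i = Root}" by blast
  qed (auto simp: root_set_def)
  moreover have "inj_on (rim_at N) {i \<in> {0..<int N}. w i = Root}"
    by (auto simp: inj_on_def rim_at_eq_iff)
  ultimately show ?thesis by (simp add: card_image)
qed

text \<open>A rim vertex, its two rim neighbours and the centre are four different vertices, so the
  parent of \<open>rim_at N i\<close> reveals the letter \<open>w i\<close>.\<close>

lemma word_parent_inj:
  assumes "periodic N w" "periodic N w'" "word_parent N w c = word_parent N w' c'"
  shows "w = w'" "c = c'"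
proof -
  show "c = c'" using assms(3) by (metis word_parent_center)
  show "w = w'"
  proof
    fix i
    have "word_parent N w c (rim_at N i) = word_parent N w' c' (rim_at N i)" using assms by simp
    then show "w i = w' i"
      using rim_at_neq_neighbours[of i] rim_at_neq_neighbours[of i, symmetric] rim_at_neq[of i]
        rim_at_neq[of "i + 1"] rim_at_neq[of "i - 1"]
      unfolding word_parent_rim_at[OF assms(1)] word_parent_rim_at[OF assms(2)]
      by (cases "w i"; cases "w' i") simp_all
  qed
qed

text \<open>The parent of a rim vertex outside \<open>R\<close> is one of its three neighbours,
  hence encoded by \<open>Hub\<close>, \<open>Lft\<close> or \<open>Rgt\<close>; this also justifies
  the default branch \<open>Rgt\<close> of \<open>w\<close>.\<close>

lemma word_exists:
  assumes R: "R \<subseteq> rim N" and root: "\<And>v. v \<in> R \<Longrightarrow> q v = v"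
    and edge: "\<And>v. v \<in> rim N - R \<Longrightarrow> {v, q v} \<in> edges (wheel N)"
    and out: "\<And>v. v \<notin> vertices (wheel N) \<Longrightarrow> q v = v"
  shows "\<exists>w. periodic N w \<and> root_set N w = R \<and> word_parent N w (q Center) = q"
proof -
  define w where "w i = (if rim_at N i \<in> R then Root else if q (rim_at N i) = Center then Hub
    else if q (rim_at N i) = rim_at N (i - 1) then Lft else Rgt)" for i
  have per: "periodic N w" by (simp add: periodic_def w_def)
  have rs: "root_set N w = R"
  proof (intro equalityI subsetI)
    fix v assume v: "v \<in> R"
    then obtain i where i: "v = rim_at N i" using R by (auto simp: rim_eq)
    with v have "w i = Root" by (simp add: w_def)
    with i show "v \<in> root_set N w" by (auto simp: root_set_def)
  qed (auto simp: root_set_def w_def split: if_splits)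
  have "word_parent N w (q Center) v = q v" for v
  proof -
    consider "v = Center" | "v \<notin> vertices (wheel N)" | i where "v = rim_at N i"
      by (auto simp: wheel_vertices rim_eq)
    then show ?thesis
    proof cases
      case 3
      have "q v = Center \<or> q v = rim_at N (i - 1) \<or> q v = rim_at N (i + 1)" if "rim_at N i \<notin> R"
        using edge[of v] that 3 by (simp add: rim_at_edge)
      then show ?thesis
        unfolding 3 word_parent_rim_at[OF per] using root[of v] 3 by (auto simp: w_def)
    qed (simp_all add: word_parent_outside out)
  qed
  with per rs show ?thesis by blast
qed

lemma walk:
  assumes per: "periodic N w" and x: "(x, \<sigma>) \<in> {(Lft, -1), (Rgt, 1)}"
    and run: "\<forall>l<k. w (i + \<sigma> * int l) = x" and "m \<le> k"
  shows "(word_parent N w c ^^ m) (rim_at N i) = rim_at N (i + \<sigma> * int m)"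
  using \<open>m \<le> k\<close>
proof (induction m)
  case (Suc m)
  then have "w (i + \<sigma> * int m) = x" using run by simp
  then show ?case using Suc x by (auto simp: word_parent_rim_at[OF per] algebra_simps)
qed simp

text \<open>The two vertices are each other's parent and trap the orbit; hence the word of a parent
  map must be compatible.\<close>

lemma reverse_pair_no_root:
  assumes per: "periodic N w" and bad: "w i = Rgt" "w (i + 1) = Lft"
  shows "(word_parent N w c ^^ k) (rim_at N i) \<in> {rim_at N i, rim_at N (i + 1)}"
  by (induction k) (auto simp: word_parent_rim_at[OF per] bad)

text \<open>The last conclusion excludes roots before the stop; it is what shows that a wrong parent
  of the centre closes a rootless cycle.\<close>

lemma leads_reaches:
  assumes per: "periodic N w" and "leads w y i"
  obtains k j where "(word_parent N w c ^^ k) (rim_at N i) = rim_at N j" "w j = y"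
    "\<forall>l<k. \<exists>j'. (word_parent N w c ^^ l) (rim_at N i) = rim_at N j' \<and> w j' \<in> {Lft, Rgt}"
proof -
  from assms(2) obtain x \<sigma> k where x: "(x, \<sigma>) \<in> {(Lft, -1), (Rgt, 1)}"
    and k: "w (i + \<sigma> * int k) = y" "\<forall>l<k. w (i + \<sigma> * int l) = x"
    unfolding leads_def by blast
  note walk = walk[OF per x k(2)]
  show thesis
  proof
    show "(word_parent N w c ^^ k) (rim_at N i) = rim_at N (i + \<sigma> * int k)" by (rule walk) simp
    show "w (i + \<sigma> * int k) = y" by fact
    show "\<forall>l<k. \<exists>j'. (word_parent N w c ^^ l) (rim_at N i) = rim_at N j' \<and> w j' \<in> {Lft, Rgt}"
      using walk k(2) x by (metis insertCI insertE less_imp_le_nat prod.inject singletonD)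
  qed
qed

text \<open>Follow the arrow at \<open>i\<close>. Some root exists, so the run of equal arrows ends,
  and compatibility forbids the opposite arrow at its end.\<close>

lemma leads_root_or_hub:
  assumes w: "w \<in> words N r" and r: "1 \<le> r"
  shows "leads w Root i \<or> leads w Hub i"
proof (cases "w i \<in> {Root, Hub}")
  case True
  then have "leads w (w i) i" unfolding leads_def by (intro bexI[of _ "(Lft, -1)"]) (auto intro: exI[of _ 0])
  with True show ?thesis by auto
next
  case False
  define \<sigma> :: int where "\<sigma> = (if w i = Lft then -1 else 1)"
  have x: "(w i, \<sigma>) \<in> {(Lft, -1), (Rgt, 1)}"
    using False by (cases "w i") (auto simp: \<sigma>_def)
  have per: "periodic N w" and comp: "\<And>j. compatible (w j) (w (j + 1))"
    using w by (auto simp: words_def)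
  have "card {j \<in> {0..<int N}. w j = Root} \<noteq> 0"
    using w r by (simp add: words_def)
  then have "{j \<in> {0..<int N}. w j = Root} \<noteq> {}" by (metis card.empty)
  then obtain j where j: "w j = Root" by auto
  \<comment> \<open>The number of steps from \<open>i\<close> to the root \<open>j\<close> in
    direction \<open>\<sigma>\<close> is \<open>\<sigma> * (j - i)\<close> modulo \<open>N\<close>,
    since \<open>\<sigma> * \<sigma> = 1\<close>.\<close>
  have "i + \<sigma> * int (nat ((\<sigma> * (j - i)) mod int N)) = i + \<sigma> * ((\<sigma> * (j - i)) mod int N)"
    using N by simp
  moreover have "(i + \<sigma> * ((\<sigma> * (j - i)) mod int N)) mod int N = (i + \<sigma> * (\<sigma> * (j - i))) mod int N"
    by (metis mod_add_right_eq mod_mult_right_eq)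
  moreover have "i + \<sigma> * (\<sigma> * (j - i)) = j" by (simp add: \<sigma>_def)
  ultimately have "w (i + \<sigma> * int (nat ((\<sigma> * (j - i)) mod int N))) = w j"
    by (intro periodic_eq[OF per]) (simp only:)
  then have ex: "\<exists>k. w (i + \<sigma> * int k) \<noteq> w i" using j False by (metis insertCI)
  define k where "k = (LEAST k. w (i + \<sigma> * int k) \<noteq> w i)"
  have k: "w (i + \<sigma> * int k) \<noteq> w i" unfolding k_def by (rule LeastI_ex[OF ex])
  have run: "\<forall>l<k. w (i + \<sigma> * int l) = w i" unfolding k_def using not_less_Least by blast
  have "k \<noteq> 0" using k by (intro notI) simp
  then obtain l where l: "k = Suc l" by (cases k) auto
  have "w (i + \<sigma> * int l) = w i" using run l by simp
  \<comment> \<open>No \<open>Lft\<close> may follow a \<open>Rgt\<close> and no \<open>Rgt\<close>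
    may precede a \<open>Lft\<close>; the two instances of \<open>comp\<close> serve the two
    directions.\<close>
  then have "w (i + \<sigma> * int k) \<in> {Root, Hub}"
    using k x comp[of "i + \<sigma> * int l"] comp[of "i + \<sigma> * int k"]
    by (cases "w (i + \<sigma> * int k)") (auto simp: l algebra_simps)
  moreover have "leads w (w (i + \<sigma> * int k)) i"
    unfolding leads_def using x run by blast
  ultimately show ?thesis by auto
qed

end

definition word_of :: "letter list \<Rightarrow> int \<Rightarrow> letter" where
  "word_of xs i = xs ! nat (i mod int (length xs))"

fun swap_letter :: "letter \<Rightarrow> letter" where
  "swap_letter Lft = Rgt"
| "swap_letter Rgt = Lft"
| "swap_letter a = a"

lemma swap_letter_swap [simp]: "swap_letter (swap_letter a) = a"
  by (cases a) auto

lemma swap_letter_eq_iff: "swap_letter a = b \<longleftrightarrow> a = swap_letter b"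
  by auto

lemma leads_shift: "leads (\<lambda>i. w (i + a)) y i \<longleftrightarrow> leads w y (i + a)"
  unfolding leads_def by (simp add: algebra_simps)

section \<open>Parent maps correspond to compatible cyclic words\<close>

context
  fixes N r :: nat
  assumes N: "3 \<le> N" and r: "1 \<le> r"
begin

lemma rooted_edge:
  assumes per: "periodic N w" and v: "v \<in> rim N - root_set N w"
  shows "{v, word_parent N w c v} \<in> edges (wheel N)"
proof -
  obtain i where i: "v = rim_at N i" using v by (auto simp: rim_eq[OF N])
  then have "w i \<noteq> Root" using v rim_at_in_root_set[OF N per] by auto
  then show ?thesis
    unfolding i rim_at_edge[OF N] by (cases "w i") (auto simp: word_parent_rim_at[OF N per])
qed

lemma word_parent_root:
  assumes per: "periodic N w" and v: "v \<in> root_set N w"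
  shows "word_parent N w c v = v"
proof -
  obtain i where "v = rim_at N i" "w i = Root" using v by (auto simp: root_set_def)
  then show ?thesis by (simp add: word_parent_rim_at[OF N per])
qed

text \<open>The walk along the rim stops at a root, or at a \<open>Hub\<close>, from which one
  further step arrives at the centre.\<close>

lemma reach_root_or_center:
  assumes w: "w \<in> words N r" and v: "v \<in> vertices (wheel N)"
  shows "\<exists>k. (word_parent N w c ^^ k) v \<in> root_set N w \<union> {Center}"
proof (cases "v = Center")
  case True
  then show ?thesis by (intro exI[of _ 0]) simp
next
  case False
  then obtain i where i: "v = rim_at N i" using v by (auto simp: wheel_vertices[OF N] rim_eq[OF N])
  have per: "periodic N w" using w by (simp add: words_def)
  from leads_root_or_hub[OF N w r, of i] show ?thesis
  proof
    assume "leads w Root i"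
    then obtain k j where "(word_parent N w c ^^ k) (rim_at N i) = rim_at N j" "w j = Root"
      using leads_reaches[OF N per] by metis
    then show ?thesis using rim_at_in_root_set[OF N per] i by (intro exI[of _ k]) simp
  next
    assume "leads w Hub i"
    then obtain k j where "(word_parent N w c ^^ k) (rim_at N i) = rim_at N j" "w j = Hub"
      using leads_reaches[OF N per] by metis
    then show ?thesis using i by (intro exI[of _ "Suc k"]) (simp add: word_parent_rim_at[OF N per])
  qed
qed

lemma center_not_in_root_set: "Center \<notin> root_set N w"
  by (auto simp: root_set_def rim_at_def)

lemma word_parent_in_parent_maps_with_center:
  assumes w: "w \<in> words N r"
  shows "word_parent N w Center \<in> parent_maps (wheel N) ({Center} \<union> root_set N w)"
proof -
  have per: "periodic N w" using w by (simp add: words_def)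
  show ?thesis
    unfolding parent_maps_def
  proof (intro CollectI conjI allI ballI impI)
    fix v assume "v \<notin> vertices (wheel N) - ({Center} \<union> root_set N w)"
    then show "word_parent N w Center v = v"
      using word_parent_root[OF per] word_parent_outside[OF N] word_parent_center[OF N] by blast
  next
    fix v assume "v \<in> vertices (wheel N) - ({Center} \<union> root_set N w)"
    then show "{v, word_parent N w Center v} \<in> edges (wheel N)"
      by (intro rooted_edge[OF per]) (simp add: wheel_vertices[OF N])
  next
    fix v assume "v \<in> vertices (wheel N)"
    then show "\<exists>k. (word_parent N w Center ^^ k) v \<in> {Center} \<union> root_set N w"
      using reach_root_or_center[OF w] by (metis Un_commute)
  qed
qed

text \<open>Every vertex reaches a root or the centre, and the centre goes on through
  \<open>rim_at N j\<close>, whose walk ends in a root.\<close>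

lemma word_parent_in_parent_maps:
  assumes w: "w \<in> words N r" and j: "leads w Root j"
  shows "word_parent N w (rim_at N j) \<in> parent_maps (wheel N) (root_set N w)"
proof -
  have per: "periodic N w" using w by (simp add: words_def)
  let ?q = "word_parent N w (rim_at N j)"
  obtain k0 j0 where "(?q ^^ k0) (rim_at N j) = rim_at N j0" "w j0 = Root"
    using leads_reaches[OF N per j] by metis
  then have k0: "(?q ^^ Suc k0) Center \<in> root_set N w"
    using rim_at_in_root_set[OF N per] by (simp add: funpow_swap1 word_parent_center[OF N])
  show ?thesis
    unfolding parent_maps_def
  proof (intro CollectI conjI allI ballI impI)
    fix v assume "v \<notin> vertices (wheel N) - root_set N w"
    then show "?q v = v"
      using word_parent_root[OF per] word_parent_outside[OF N] by blast
  next
    fix v assume v: "v \<in> vertices (wheel N) - root_set N w"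
    show "{v, ?q v} \<in> edges (wheel N)"
    proof (cases "v = Center")
      case True
      then show ?thesis
        by (simp add: word_parent_center[OF N] center_edge[OF N] rim_at_in_rim[OF N])
    qed (use v in \<open>auto intro!: rooted_edge[OF per] simp: wheel_vertices[OF N]\<close>)
  next
    fix v assume "v \<in> vertices (wheel N)"
    then obtain k where k: "(?q ^^ k) v \<in> root_set N w \<union> {Center}"
      using reach_root_or_center[OF w] by blast
    show "\<exists>k. (?q ^^ k) v \<in> root_set N w"
    proof (cases "(?q ^^ k) v = Center")
      case True
      then have "(?q ^^ (Suc k0 + k)) v = (?q ^^ Suc k0) Center"
        by (simp only: funpow_add comp_apply)
      then show ?thesis using k0 by metis
    qed (use k in blast)
  qed
qed

text \<open>The bounds on \<open>S\<close> cover both \<open>S = R\<close> and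
  \<open>S = {Center} \<union> R\<close>. Edges yield the letters, and reachability of
  \<open>S\<close> excludes the factor \<open>Rgt Lft\<close>.\<close>

lemma parent_map_is_word_parent:
  assumes R: "R \<subseteq> rim N" "card R = r" and S: "R \<subseteq> S" "S \<subseteq> {Center} \<union> R"
    and p: "p \<in> parent_maps (wheel N) S"
  shows "\<exists>w\<in>words N r. root_set N w = R \<and> word_parent N w (p Center) = p"
proof -
  have "\<exists>w. periodic N w \<and> root_set N w = R \<and> word_parent N w (p Center) = p"
  proof (rule word_exists[OF N R(1)])
    show "p v = v" if "v \<in> R" for v using parent_mapsD(1)[OF p] S that by blast
    show "p v = v" if "v \<notin> vertices (wheel N)" for v using parent_mapsD(1)[OF p] that by blast
    show "{v, p v} \<in> edges (wheel N)" if "v \<in> rim N - R" for v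
    proof (rule parent_mapsD(2)[OF p])
      show "v \<in> vertices (wheel N) - S" using that S by (auto simp: wheel_vertices[OF N] rim_def)
    qed
  qed
  then obtain w where per: "periodic N w" and rs: "root_set N w = R"
    and wp: "word_parent N w (p Center) = p" by blast
  have "compatible (w i) (w (i + 1))" for i
  proof
    assume bad: "w i = Rgt \<and> w (i + 1) = Lft"
    have "rim_at N i \<in> vertices (wheel N)" by (simp add: wheel_vertices[OF N] rim_at_in_rim[OF N])
    then obtain k where k: "(p ^^ k) (rim_at N i) \<in> S" using parent_mapsD(3)[OF p] by blast
    have "(p ^^ k) (rim_at N i) \<in> {rim_at N i, rim_at N (i + 1)}"
      using reverse_pair_no_root[OF N per, where i = i and k = k and c = "p Center"] bad wp by simp
    moreover have "rim_at N i \<notin> S" "rim_at N (i + 1) \<notin> S"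
      using S bad rim_at_in_root_set[OF N per] rs by (auto simp: rim_at_neq[OF N])
    ultimately show False using k by auto
  qed
  then have "w \<in> words N r"
    using per R(2) rs card_root_set[OF N per] by (simp add: words_def)
  with rs wp show ?thesis by blast
qed

lemma card_parent_maps_with_center:
  assumes R: "R \<subseteq> rim N" "card R = r"
  shows "card (parent_maps (wheel N) ({Center} \<union> R)) = card {w \<in> words N r. root_set N w = R}"
proof -
  have "bij_betw (\<lambda>w. word_parent N w Center) {w \<in> words N r. root_set N w = R}
    (parent_maps (wheel N) ({Center} \<union> R))"
    unfolding bij_betw_def
  proof (intro conjI equalityI subsetI)
    show "inj_on (\<lambda>w. word_parent N w Center) {w \<in> words N r. root_set N w = R}"
      by (rule inj_onI) (auto simp: words_def dest: word_parent_inj[OF N])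
    fix p assume p: "p \<in> parent_maps (wheel N) ({Center} \<union> R)"
    then have "p Center = Center" by (rule parent_mapsD) simp
    then show "p \<in> (\<lambda>w. word_parent N w Center) ` {w \<in> words N r. root_set N w = R}"
      using parent_map_is_word_parent[OF R _ _ p] by force
  qed (use word_parent_in_parent_maps_with_center in blast)
  then show ?thesis by (rule bij_betw_same_card[symmetric])
qed

text \<open>The parent of the centre is recorded by its representative \<open>j\<close> in one
  period, so that the pair is unique. The condition on \<open>j\<close> says that the centre reaches
  a root: a walk ending at \<open>Hub\<close> would return to the centre.\<close>

lemma card_parent_maps:
  assumes R: "R \<subseteq> rim N" "card R = r"
  shows "card (parent_maps (wheel N) R) =
    card {x \<in> (SIGMA w:words N r. {j \<in> {0..<int N}. leads w Root j}). root_set N (fst x) = R}"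
    (is "_ = card ?W")
proof -
  have "bij_betw (\<lambda>x. word_parent N (fst x) (rim_at N (snd x))) ?W (parent_maps (wheel N) R)"
    unfolding bij_betw_def
  proof (intro conjI equalityI subsetI)
    show "inj_on (\<lambda>x. word_parent N (fst x) (rim_at N (snd x))) ?W"
    proof (rule inj_onI)
      fix x y assume x: "x \<in> ?W" and y: "y \<in> ?W"
        and eq: "word_parent N (fst x) (rim_at N (snd x)) = word_parent N (fst y) (rim_at N (snd y))"
      have "periodic N (fst x)" "periodic N (fst y)" using x y by (auto simp: words_def)
      note inj = word_parent_inj[OF N this eq]
      have "snd x = snd y" using inj(2) x y by (auto simp: rim_at_eq_iff[OF N])
      with inj(1) show "x = y" by (simp add: prod_eq_iff)
    qed
    show "p \<in> parent_maps (wheel N) R"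
      if "p \<in> (\<lambda>x. word_parent N (fst x) (rim_at N (snd x))) ` ?W" for p
      using that word_parent_in_parent_maps by auto
    fix p assume p: "p \<in> parent_maps (wheel N) R"
    then obtain w where w: "w \<in> words N r" "root_set N w = R" "word_parent N w (p Center) = p"
      using parent_map_is_word_parent[OF R _ _ p] by blast
    have per: "periodic N w" using w by (simp add: words_def)
    have "{Center, p Center} \<in> edges (wheel N)"
      using R by (intro parent_mapsD(2)[OF p]) (auto simp: wheel_vertices[OF N] rim_def)
    then obtain j' where "p Center = rim_at N j'" by (auto simp: center_edge[OF N] rim_eq[OF N])
    define j where "j = j' mod int N"
    have j: "j \<in> {0..<int N}" "p Center = rim_at N j"
      using N \<open>p Center = rim_at N j'\<close> by (simp_all add: j_def rim_at_mod[OF N])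
    have "leads w Root j"
    proof (rule ccontr)
      assume "\<not> leads w Root j"
      then have "leads w Hub j" using leads_root_or_hub[OF N w(1) r] by blast
      then obtain k j2 where k: "(p ^^ k) (rim_at N j) = rim_at N j2" "w j2 = Hub"
        and l: "\<forall>l<k. \<exists>j'. (p ^^ l) (rim_at N j) = rim_at N j' \<and> w j' \<in> {Lft, Rgt}"
        by (rule leads_reaches[OF N per, where c = "p Center", unfolded w(3)])
      have "p (rim_at N j2) = Center"
        using word_parent_rim_at[OF N per, of "p Center" j2] k(2) unfolding w(3) by simp
      then have Suc_k: "(p ^^ Suc k) (rim_at N j) = Center" using k by simp
      \<comment> \<open>A cycle of \<open>k\<close> steps along the rim, one to the centre and one
        back to \<open>rim_at N j\<close>. It contains no root, so the whole orbit misses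
        \<open>R\<close>.\<close>
      then have cyc: "(p ^^ Suc (Suc k)) (rim_at N j) = rim_at N j" using j by simp
      have no: "(p ^^ m) (rim_at N j) \<notin> R" if m: "m < Suc (Suc k)" for m
      proof -
        consider "m < k" | "m = k" | "m = Suc k" using m by linarith
        then show ?thesis
        proof cases
          case 1
          then obtain j' where "(p ^^ m) (rim_at N j) = rim_at N j'" "w j' \<in> {Lft, Rgt}" using l by blast
          then show ?thesis using rim_at_in_root_set[OF N per] w(2) by auto
        next
          case 2
          then show ?thesis using k rim_at_in_root_set[OF N per] w(2) by auto
        next
          case 3
          then show ?thesis using Suc_k center_not_in_root_set w(2) by metis
        qed
      qed
      have "(p ^^ m) (rim_at N j) \<notin> R" for m
        using no[of "m mod Suc (Suc k)"] funpow_mod_eq[OF cyc, of m] by simp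
      moreover have "rim_at N j \<in> vertices (wheel N)"
        by (simp add: wheel_vertices[OF N] rim_at_in_rim[OF N])
      ultimately show False using parent_mapsD(3)[OF p] by blast
    qed
    with w j have "(w, j) \<in> ?W" by simp
    moreover have "p = word_parent N (fst (w, j)) (rim_at N (snd (w, j)))" using w j by simp
    ultimately show "p \<in> (\<lambda>x. word_parent N (fst x) (rim_at N (snd x))) ` ?W" by blast
  qed
  then show ?thesis by (rule bij_betw_same_card[symmetric])
qed

subsection \<open>Counting cyclic words\<close>

lemma finite_words: "finite (words N r)"
proof (rule finite_subset)
  show "words N r \<subseteq> word_of ` {xs. set xs \<subseteq> UNIV \<and> length xs = N}"
  proof
    fix w assume "w \<in> words N r"
    then have per: "\<And>i. w (i mod int N) = w i" by (simp add: words_def periodic_def)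
    have "w = word_of (map (\<lambda>i. w (int i)) [0..<N])"
    proof
      fix i
      have "nat (i mod int N) < N" using N by (simp add: nat_less_iff)
      then show "w i = word_of (map (\<lambda>i. w (int i)) [0..<N]) i"
        using N per by (simp add: word_of_def)
    qed
    then show "w \<in> word_of ` {xs. set xs \<subseteq> UNIV \<and> length xs = N}" by force
  qed
  show "finite (word_of ` {xs. set xs \<subseteq> UNIV \<and> length xs = N})"
    by (intro finite_imageI finite_lists_length_eq finite_letter)
qed

lemma finite_root_sets: "finite {R. R \<subseteq> rim N \<and> card R = r}"
  by (rule finite_subset[of _ "Pow (rim N)"]) (auto simp: rim_def)

text \<open>The root sets partition \<open>X\<close>; the map \<open>f\<close> lets this serve both
  for words and for pairs of a word and an index.\<close>

lemma sum_card_fibres: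
  assumes "finite X" and "\<And>x. x \<in> X \<Longrightarrow> f x \<in> words N r"
  shows "(\<Sum>R | R \<subseteq> rim N \<and> card R = r. card {x \<in> X. root_set N (f x) = R}) = card X"
proof -
  have "root_set N (f x) \<subseteq> rim N \<and> card (root_set N (f x)) = r" if "x \<in> X" for x
    using assms(2)[OF that] root_set_subset[OF N] card_root_set[OF N] by (auto simp: words_def)
  then have "(\<Sum>R | R \<subseteq> rim N \<and> card R = r. \<Sum>x | x \<in> X \<and> root_set N (f x) = R. 1) = (\<Sum>x\<in>X. 1::nat)"
    by (intro sum.group finite_root_sets assms(1)) auto
  then show ?thesis by simp
qed

lemma B_sum_eq: "B_sum N r = card (words N r)"
proof -
  have "B_sum N r = (\<Sum>R | R \<subseteq> rim N \<and> card R = r. card {w \<in> words N r. root_set N w = R})"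
    unfolding B_sum_def
  proof (rule sum.cong[OF refl])
    fix R assume "R \<in> {R. R \<subseteq> rim N \<and> card R = r}"
    then have R: "R \<subseteq> rim N" "card R = r" by auto
    have "num_rooted_forests (wheel N) ({Center} \<union> R) = card (parent_maps (wheel N) ({Center} \<union> R))"
      using R by (intro num_rooted_forests_eq_card_parent_maps simple_graph_wheel N)
        (auto simp: wheel_vertices[OF N])
    then show "num_rooted_forests (wheel N) ({Center} \<union> R) = card {w \<in> words N r. root_set N w = R}"
      using card_parent_maps_with_center[OF R] by simp
  qed
  also have "\<dots> = card (words N r)"
    by (rule sum_card_fibres[OF finite_words])
  finally show ?thesis .
qed

lemma A_sum_eq: "A_sum N r = (\<Sum>w\<in>words N r. card {j \<in> {0..<int N}. leads w Root j})"
proof -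
  let ?X = "SIGMA w:words N r. {j \<in> {0..<int N}. leads w Root j}"
  have fin: "finite {j \<in> {0..<int N}. leads w Root j}" for w
    by (rule finite_subset[of _ "{0..<int N}"]) auto
  have "A_sum N r = (\<Sum>R | R \<subseteq> rim N \<and> card R = r. card {x \<in> ?X. root_set N (fst x) = R})"
    unfolding A_sum_def
  proof (rule sum.cong[OF refl])
    fix R assume "R \<in> {R. R \<subseteq> rim N \<and> card R = r}"
    then have R: "R \<subseteq> rim N" "card R = r" by auto
    have "num_rooted_forests (wheel N) R = card (parent_maps (wheel N) R)"
      using R by (intro num_rooted_forests_eq_card_parent_maps simple_graph_wheel N)
        (auto simp: wheel_vertices[OF N])
    then show "num_rooted_forests (wheel N) R = card {x \<in> ?X. root_set N (fst x) = R}"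
      using card_parent_maps[OF R] by simp
  qed
  also have "\<dots> = card ?X"
    by (rule sum_card_fibres[OF finite_SigmaI[OF finite_words fin]]) auto
  also have "\<dots> = (\<Sum>w\<in>words N r. card {j \<in> {0..<int N}. leads w Root j})"
    by (intro card_SigmaI finite_words ballI fin)
  finally show ?thesis .
qed

section \<open>Rotations and reflections of cyclic words\<close>

lemma card_roots_reindex:
  assumes per: "periodic N w" and \<sigma>: "\<sigma> = 1 \<or> \<sigma> = - 1"
  shows "card {i \<in> {0..<int N}. w (\<sigma> * i + a) = Root} = card {i \<in> {0..<int N}. w i = Root}"
proof (rule bij_betw_same_card)
  have w: "w (i mod int N) = w i" for i using per by (simp add: periodic_def)
  \<comment> \<open>Modulo \<open>N\<close>, the map taking \<open>i\<close> to
    \<open>\<sigma> * i + a\<close> is inverted by \<open>\<sigma> * (i - a)\<close>, because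
    \<open>\<sigma> * \<sigma> = 1\<close>.\<close>
  have inv1: "(\<sigma> * ((\<sigma> * i + a) mod int N - a)) mod int N = i mod int N" for i
  proof -
    have "(\<sigma> * ((\<sigma> * i + a) mod int N - a)) mod int N = (\<sigma> * ((\<sigma> * i + a) - a)) mod int N"
      by (metis mod_diff_left_eq mod_mult_right_eq)
    then show ?thesis using \<sigma> by auto
  qed
  have inv2: "(\<sigma> * ((\<sigma> * (i - a)) mod int N) + a) mod int N = i mod int N" for i
  proof -
    have "(\<sigma> * ((\<sigma> * (i - a)) mod int N) + a) mod int N = (\<sigma> * (\<sigma> * (i - a)) + a) mod int N"
      by (metis mod_add_left_eq mod_mult_right_eq)
    then show ?thesis using \<sigma> by auto
  qed
  have e: "w (\<sigma> * ((\<sigma> * (i - a)) mod int N) + a) = w i" for i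
    by (rule periodic_eq[OF N per inv2])
  show "bij_betw (\<lambda>i. (\<sigma> * i + a) mod int N) {i \<in> {0..<int N}. w (\<sigma> * i + a) = Root}
      {i \<in> {0..<int N}. w i = Root}"
    by (rule bij_betw_byWitness[where f' = "\<lambda>i. (\<sigma> * (i - a)) mod int N"])
      (use N in \<open>auto simp: w e inv1 inv2\<close>)
qed

lemma words_shift: "w \<in> words N r \<Longrightarrow> (\<lambda>i. w (i + a)) \<in> words N r"
proof -
  assume w: "w \<in> words N r"
  then have per: "periodic N w" by (simp add: words_def)
  have "w (i mod int N + a) = w (i + a)" for i
    by (rule periodic_eq[OF N per]) (simp add: mod_simps)
  moreover have "compatible (w (i + a)) (w (i + 1 + a))" for i
    using w by (auto simp: words_def add.commute add.left_commute)
  ultimately show ?thesis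
    using w card_roots_reindex[OF per, of 1 a] by (auto simp: words_def periodic_def)
qed

text \<open>Reversing positions and exchanging the directions carries the factor
  \<open>Rgt Lft\<close> to itself.\<close>

lemma words_reflect: "w \<in> words N r \<Longrightarrow> (\<lambda>i. swap_letter (w (- i))) \<in> words N r"
proof -
  assume w: "w \<in> words N r"
  then have per: "periodic N w" by (simp add: words_def)
  have "w (- (i mod int N)) = w (- i)" for i
    by (rule periodic_eq[OF N per]) (simp add: mod_simps)
  moreover have "compatible (swap_letter (w (- i))) (swap_letter (w (- (i + 1))))" for i
  proof -
    have "compatible (w (- i - 1)) (w (- i - 1 + 1))" using w unfolding words_def by blast
    then show ?thesis by (auto simp: swap_letter_eq_iff)
  qed
  ultimately show ?thesis
    using w card_roots_reindex[OF per, of "- 1" 0]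
    by (auto simp: words_def periodic_def swap_letter_eq_iff)
qed

lemma card_words_shift:
  assumes "\<And>w. Q w \<longleftrightarrow> P (\<lambda>i. w (i + a))"
  shows "card {w \<in> words N r. Q w} = card {w \<in> words N r. P w}"
proof (rule bij_betw_same_card, rule bij_betw_byWitness[where f' = "\<lambda>w i. w (i - a)"])
  show "(\<lambda>w i. w (i + a)) ` {w \<in> words N r. Q w} \<subseteq> {w \<in> words N r. P w}"
    using assms words_shift by auto
  show "(\<lambda>w i. w (i - a)) ` {w \<in> words N r. P w} \<subseteq> {w \<in> words N r. Q w}"
    using assms words_shift[of _ "- a"] by auto
qed auto

lemma card_words_reflect:
  assumes "\<And>w. Q w \<longleftrightarrow> P (\<lambda>i. swap_letter (w (- i)))"
  shows "card {w \<in> words N r. Q w} = card {w \<in> words N r. P w}"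
proof (rule bij_betw_same_card, rule bij_betw_byWitness[where f' = "\<lambda>w i. swap_letter (w (- i))"])
  show "(\<lambda>w i. swap_letter (w (- i))) ` {w \<in> words N r. Q w} \<subseteq> {w \<in> words N r. P w}"
    using assms words_reflect by auto
  show "(\<lambda>w i. swap_letter (w (- i))) ` {w \<in> words N r. P w} \<subseteq> {w \<in> words N r. Q w}"
    using assms words_reflect by auto
qed auto

text \<open>Count pairs of a word and a root position: \<open>r\<close> for each word, and by
  rotation equally many for each of the \<open>N\<close> positions.\<close>

lemma root_double_count: "r * card (words N r) = N * card {w \<in> words N r. w 0 = Root}"
proof -
  have "(\<Sum>w\<in>words N r. card {j \<in> {0..<int N}. w j = Root}) =
      card {w \<in> words N r. w 0 = Root} * card {0..<int N}"
    by (intro sum_multicount finite_words ballI card_words_shift) auto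
  moreover have "(\<Sum>w\<in>words N r. card {j \<in> {0..<int N}. w j = Root}) = (\<Sum>w\<in>words N r. r)"
    by (rule sum.cong) (auto simp: words_def)
  ultimately show ?thesis by (simp add: mult.commute)
qed

lemma leads_double_count:
  "(\<Sum>w\<in>words N r. card {j \<in> {0..<int N}. leads w Root j}) =
    N * card {w \<in> words N r. leads w Root 0}"
proof -
  have "(\<Sum>w\<in>words N r. card {j \<in> {0..<int N}. leads w Root j}) =
      card {w \<in> words N r. leads w Root 0} * card {0..<int N}"
    by (intro sum_multicount finite_words ballI card_words_shift) (auto simp: leads_shift)
  then show ?thesis by (simp add: mult.commute)
qed

text \<open>Split by direction and length \<open>k\<close> of the walk from \<open>0\<close>.
  Reflection equates the directions, and rotation brings the root to \<open>0\<close>; walks of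
  length 0 have no direction and count once.\<close>

lemma card_leads:
  "card {w \<in> words N r. leads w Root 0} = card {w \<in> words N r. w 0 = Root} +
    2 * (\<Sum>k = 1..<N. card {w \<in> words N r. w 0 = Root \<and> (\<forall>l\<in>{1..k}. w (int l) = Lft)})"
proof -
  define F where "F x \<sigma> k = {w \<in> words N r. w (\<sigma> * int k) = Root \<and> (\<forall>l<k. w (\<sigma> * int l) = x)}"
    for x and \<sigma> :: int and k
  have finF: "finite (F x \<sigma> k)" for x \<sigma> k
    unfolding F_def using finite_words by simp
  have F0: "w 0 = x" if "w \<in> F x \<sigma> k" "1 \<le> k" for w x \<sigma> k
    using that by (auto simp: F_def)
  \<comment> \<open>After \<open>N\<close> or more steps, step \<open>k - N\<close> of the walk
    would be at the position of the last one, which would carry both \<open>x\<close> and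
    \<open>Root\<close>.\<close>
  have small: "k < N" if "w \<in> F x \<sigma> k" "x \<noteq> Root" for w x \<sigma> k
  proof (rule ccontr)
    assume "\<not> k < N"
    then have "int (k - N) = int k - int N" "k - N < k" using N by auto
    then have "w (\<sigma> * (int k - int N)) = x" using that by (auto simp: F_def)
    moreover have "w (\<sigma> * (int k - int N)) = w (\<sigma> * int k)"
    proof (rule periodic_eq[OF N])
      show "periodic N w" using that by (simp add: F_def words_def)
      show "(\<sigma> * (int k - int N)) mod int N = \<sigma> * int k mod int N"
        by (simp add: right_diff_distrib mod_eq_dvd_iff)
    qed
    ultimately show False using that by (simp add: F_def)
  qed
  have cardUN: "card (\<Union>k\<in>{1..<N}. F x \<sigma> k) = (\<Sum>k = 1..<N. card (F x \<sigma> k))" if "x \<noteq> Root" for x \<sigma>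
  proof (rule card_UN_disjoint)
    \<comment> \<open>The longer walk passes the place where the shorter one stops, so
      \<open>Root\<close> and \<open>x\<close> would meet there.\<close>
    have "False" if "w \<in> F x \<sigma> k" "w \<in> F x \<sigma> k'" "k < k'" for w k k'
      using that \<open>x \<noteq> Root\<close> by (auto simp: F_def)
    then show "\<forall>i\<in>{1..<N}. \<forall>j\<in>{1..<N}. i \<noteq> j \<longrightarrow> F x \<sigma> i \<inter> F x \<sigma> j = {}"
      by (meson disjoint_iff linorder_neqE_nat)
  qed (use finF in auto)
  \<comment> \<open>Rotation by \<open>k\<close> moves the root from \<open>- k\<close> to
    \<open>0\<close> and the walk to the positions \<open>1\<close> to \<open>k\<close>; step
    \<open>l\<close> becomes position \<open>k - l\<close>.\<close>
  have L: "card (F Lft (- 1) k) =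
      card {w \<in> words N r. w 0 = Root \<and> (\<forall>l\<in>{1..k}. w (int l) = Lft)}" for k
    unfolding F_def
  proof (rule card_words_shift[of _ _ "- int k"])
    fix w :: "int \<Rightarrow> letter"
    have "(\<forall>l<k. w (- 1 * int l) = Lft) \<longleftrightarrow> (\<forall>l\<in>{1..k}. w (int l + - int k) = Lft)"
    proof (intro iffI allI ballI impI)
      fix l assume *: "\<forall>l<k. w (- 1 * int l) = Lft" "l \<in> {1..k}"
      then have "k - l < k" "- 1 * int (k - l) = int l + - int k" by auto
      with * show "w (int l + - int k) = Lft" by metis
    next
      fix l assume *: "\<forall>l\<in>{1..k}. w (int l + - int k) = Lft" "l < k"
      then have "k - l \<in> {1..k}" "- 1 * int l = int (k - l) + - int k" by auto
      with * show "w (- 1 * int l) = Lft" by metis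
    qed
    then show "w (- 1 * int k) = Root \<and> (\<forall>l<k. w (- 1 * int l) = Lft) \<longleftrightarrow>
      w (0 + - int k) = Root \<and> (\<forall>l\<in>{1..k}. w (int l + - int k) = Lft)" by simp
  qed
  have R: "card (F Rgt 1 k) = card (F Lft (- 1) k)" for k
    unfolding F_def by (rule card_words_reflect) (auto simp: swap_letter_eq_iff)
  have "{w \<in> words N r. leads w Root 0} =
    {w \<in> words N r. w 0 = Root} \<union> (\<Union>k\<in>{1..<N}. F Lft (- 1) k) \<union> (\<Union>k\<in>{1..<N}. F Rgt 1 k)"
    (is "?A = ?B \<union> ?L \<union> ?R")
  proof -
    have "?A = (\<Union>k. F Lft (- 1) k) \<union> (\<Union>k. F Rgt 1 k)"
      unfolding leads_def F_def by auto
    moreover have "(\<Union>k. F x \<sigma> k) = ?B \<union> (\<Union>k\<in>{1..<N}. F x \<sigma> k)" if "x \<noteq> Root" for x \<sigma>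
    proof (intro equalityI subsetI)
      fix w assume "w \<in> (\<Union>k. F x \<sigma> k)"
      then obtain k where k: "w \<in> F x \<sigma> k" by blast
      then show "w \<in> ?B \<union> (\<Union>k\<in>{1..<N}. F x \<sigma> k)"
      proof (cases "k = 0")
        case True
        then show ?thesis using k by (simp add: F_def)
      next
        case False
        then have "k \<in> {1..<N}" using small[OF k that] by simp
        then show ?thesis using k by blast
      qed
    next
      fix w assume "w \<in> ?B \<union> (\<Union>k\<in>{1..<N}. F x \<sigma> k)"
      moreover have "?B = F x \<sigma> 0" by (simp add: F_def)
      ultimately show "w \<in> (\<Union>k. F x \<sigma> k)" by blast
    qed
    ultimately show ?thesis by auto
  qed
  \<comment> \<open>The letter at \<open>0\<close> tells the three classes apart.\<close>
  moreover have at_0: "?B \<subseteq> {w. w 0 = Root}" "?L \<subseteq> {w. w 0 = Lft}" "?R \<subseteq> {w. w 0 = Rgt}"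
    using F0 by force+
  have "card (?B \<union> ?L \<union> ?R) = card (?B \<union> ?L) + card ?R"
  proof (rule card_Un_disjoint)
    show "(?B \<union> ?L) \<inter> ?R = {}" using at_0 by fastforce
  qed (use finF finite_words in simp_all)
  moreover have "card (?B \<union> ?L) = card ?B + card ?L"
  proof (rule card_Un_disjoint)
    show "?B \<inter> ?L = {}" using at_0 by fastforce
  qed (use finF finite_words in simp_all)
  moreover have "card ?L = (\<Sum>k = 1..<N. card {w \<in> words N r. w 0 = Root \<and> (\<forall>l\<in>{1..k}. w (int l) = Lft)})"
    by (subst cardUN) (simp_all only: L letter.distinct not_False_eq_True)
  moreover have "card ?R = card ?L"
    by (subst (1 2) cardUN) (simp_all only: R letter.distinct not_False_eq_True)
  ultimately show ?thesis by (simp only: mult_2 add.assoc)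
qed

text \<open>\<open>Root\<close> is compatible with every letter, so closing a list that starts with
  it into a cycle adds no constraint.\<close>

lemma word_of_in_words_iff:
  assumes xs: "length xs = N" "hd xs = Root"
  shows "word_of xs \<in> words N r \<longleftrightarrow>
    successively compatible xs \<and> length (filter (\<lambda>a. a = Root) xs) = r"
proof -
  have "{i \<in> {0..<int N}. word_of xs i = Root} = int ` {i. i < length xs \<and> xs ! i = Root}"
    (is "?I = int ` ?J")
  proof (intro equalityI subsetI)
    fix i assume "i \<in> ?I"
    then have "i = int (nat i)" "nat i \<in> ?J" using xs by (auto simp: word_of_def)
    then show "i \<in> int ` ?J" by blast
  qed (use xs in \<open>auto simp: word_of_def\<close>)
  then have "card ?I = length (filter (\<lambda>a. a = Root) xs)"
    by (simp add: card_image length_filter_conv_card)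
  moreover have "periodic N (word_of xs)" by (simp add: periodic_def word_of_def xs)
  moreover have "(\<forall>i. compatible (word_of xs i) (word_of xs (i + 1))) \<longleftrightarrow> successively compatible xs"
  proof
    assume *: "\<forall>i. compatible (word_of xs i) (word_of xs (i + 1))"
    show "successively compatible xs"
      unfolding successively_conv_nth
    proof (intro allI impI)
      fix i assume i: "Suc i < length xs"
      then have "word_of xs (int i) = xs ! i" "word_of xs (int i + 1) = xs ! Suc i"
        by (simp_all add: word_of_def nat_add_distrib)
      then show "compatible (xs ! i) (xs ! Suc i)" using * by metis
    qed
  next
    assume *: "successively compatible xs"
    show "\<forall>i. compatible (word_of xs i) (word_of xs (i + 1))"
    proof
      fix i
      define n where "n = nat (i mod int N)"
      have n: "n < N" "i mod int N = int n" using N by (simp_all add: n_def nat_less_iff)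
      have m: "(i + 1) mod int N = (int n + 1) mod int N" by (simp add: mod_simps flip: n(2))
      show "compatible (word_of xs i) (word_of xs (i + 1))"
      proof (cases "Suc n < N")
        case True
        then have "(int n + 1) mod int N = int (Suc n)" by simp
        then have "word_of xs (i + 1) = xs ! Suc n" using m xs by (simp only: word_of_def nat_int)
        moreover have "word_of xs i = xs ! n" using n xs by (simp add: word_of_def)
        ultimately show ?thesis using * True xs by (simp add: successively_conv_nth)
      next
        case False
        then have "int n + 1 = int N" using n by simp
        then have "word_of xs (i + 1) = xs ! 0" using m xs by (simp add: word_of_def)
        also have "\<dots> = Root" using xs N by (metis hd_conv_nth list.size(3) not_numeral_le_zero)
        finally show ?thesis by simp
      qed
    qed
  qed
  ultimately show ?thesis by (auto simp: words_def)
qed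

lemma word_of_inj: "inj_on word_of {xs. length xs = N}"
proof (rule inj_onI)
  fix xs ys assume l: "xs \<in> {xs. length xs = N}" "ys \<in> {xs. length xs = N}"
    and e: "word_of xs = word_of ys"
  show "xs = ys"
  proof (rule nth_equalityI)
    fix i assume "i < length xs"
    then show "xs ! i = ys ! i" using l fun_cong[OF e, of "int i"] by (simp add: word_of_def)
  qed (use l in simp)
qed

lemma card_words_prefix:
  assumes k: "k < N"
  shows "card {w \<in> words N r. w 0 = Root \<and> (\<forall>l\<in>{1..k}. w (int l) = Lft)} =
    (if r + k \<le> N then card (strings (N - r - k) (r - 1)) else 0)" (is "card ?E = _")
proof -
  let ?f = "\<lambda>u. Root # replicate k Lft @ u"
  let ?U = "{u. length u = N - 1 - k \<and> successively compatible u \<and>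
    length (filter (\<lambda>a. a = Root) u) = r - 1}"
  have suc: "successively compatible (?f u) \<longleftrightarrow> successively compatible u" for u
  proof -
    have "successively compatible (replicate k Lft @ u) \<longleftrightarrow> successively compatible u"
      by (induction k) (auto simp: successively_Cons)
    then show ?thesis by (auto simp: successively_Cons)
  qed
  have mem: "word_of (?f u) \<in> ?E \<longleftrightarrow> u \<in> ?U" if "length u = N - 1 - k" for u
  proof -
    have len: "length (?f u) = N" using that k by simp
    have "word_of (?f u) \<in> words N r \<longleftrightarrow> u \<in> ?U"
      unfolding word_of_in_words_iff[OF len list.sel(1)] suc using r that by auto
    moreover have "word_of (?f u) (int l) = Lft" if "l \<in> {1..k}" for l
    proof -
      have l: "l = Suc (l - 1)" "l - 1 < k" using that by auto
      have "word_of (?f u) (int l) = ?f u ! l" using len k that by (simp add: word_of_def del: length_Cons)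
      also have "\<dots> = Lft" using l(2) by (subst l(1)) (simp add: nth_append)
      finally show ?thesis .
    qed
    moreover have "word_of (?f u) 0 = Root" by (simp add: word_of_def)
    ultimately show ?thesis by auto
  qed
  have "?E = (word_of \<circ> ?f) ` ?U"
  proof (intro equalityI subsetI)
    fix w assume w: "w \<in> ?E"
    then have per: "\<And>i. w (i mod int N) = w i" by (simp add: words_def periodic_def)
    let ?u = "map (\<lambda>i. w (int i)) [Suc k..<N]"
    have lu: "length ?u = N - 1 - k" by simp
    have "w i = word_of (?f ?u) i" for i
    proof -
      define n where "n = nat (i mod int N)"
      have n: "n < N" "i mod int N = int n" using N by (simp_all add: n_def nat_less_iff)
      have "word_of (?f ?u) i = ?f ?u ! n"
        using k n by (simp add: word_of_def)
      also have "\<dots> = w (int n)"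
      proof (cases n)
        case 0
        then show ?thesis using w by simp
      next
        case (Suc n')
        show ?thesis
        proof (cases "n' < k")
          case True
          then have "n \<in> {1..k}" using Suc by simp
          then have "w (int n) = Lft" using w by blast
          then show ?thesis using Suc True by (simp add: nth_append)
        next
          case False
          then have "?f ?u ! n = ?u ! (n' - k)" using Suc by (simp add: nth_append)
          also have "\<dots> = w (int n)" using False Suc n k by (subst nth_map) auto
          finally show ?thesis .
        qed
      qed
      finally show ?thesis using per[of i] n by simp
    qed
    then have eq: "w = word_of (?f ?u)" by (rule ext)
    show "w \<in> (word_of \<circ> ?f) ` ?U"
    proof (rule image_eqI)
      show "w = (word_of \<circ> ?f) ?u" unfolding comp_apply by (rule eq)
      show "?u \<in> ?U" using w unfolding mem[OF lu, symmetric] eq[symmetric] .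
    qed
  next
    fix w assume "w \<in> (word_of \<circ> ?f) ` ?U"
    then obtain u where "w = word_of (?f u)" "u \<in> ?U" by auto
    then show "w \<in> ?E" using mem[of u] by auto
  qed
  moreover have "inj_on (word_of \<circ> ?f) ?U"
  proof (rule comp_inj_on)
    show "inj_on ?f ?U" by (rule inj_onI) simp
    show "inj_on word_of (?f ` ?U)"
      by (rule inj_on_subset[OF word_of_inj]) (use k in auto)
  qed
  ultimately have "card ?E = card ?U" by (simp only: card_image)
  \<comment> \<open>For \<open>r + k > N\<close> fewer than \<open>r - 1\<close> places remain; the
    guard keeps truncated subtraction from producing strings there.\<close>
  also have "?U = (if r + k \<le> N then strings (N - r - k) (r - 1) else {})"
  proof -
    have "length u = N - 1 - k \<longleftrightarrow>
        r + k \<le> N \<and> length (filter (\<lambda>a. a \<noteq> Root) u) = N - r - k"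
      if "length (filter (\<lambda>a. a = Root) u) = r - 1" for u
      using sum_length_filter_compl[of "\<lambda>a. a = Root" u] that r k by auto
    then show ?thesis by (auto simp: strings_def)
  qed
  finally show ?thesis by simp
qed

end

theorem theorem4p1:
  fixes N r :: nat
  assumes "3 \<le> N" and "1 \<le> r" and "r \<le> N"
  shows "real (A_sum N r) =
           real N * fps_nth ((1 + fps_X) / ((1 - fps_X) * (1 - 3 * fps_X + fps_X ^ 2) ^ r)) (N - r)
       \<and> real (B_sum N r) =
           real N / real r * fps_nth (1 / (1 - 3 * fps_X + fps_X ^ 2) ^ r) (N - r)"
proof -
  note N = assms(1) and r = assms(2)
  let ?m = "N - r" and ?s = "r - 1"
  let ?E = "\<lambda>k. {w \<in> words N r. w 0 = Root \<and> (\<forall>l\<in>{1..k}. w (int l) = Lft)}"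
  \<comment> \<open>One root is the marked one at \<open>0\<close>, so the linear words have
    \<open>r - 1\<close> roots and the exponent is \<open>Suc (r - 1)\<close>.\<close>
  have Suc_s: "Suc ?s = r" using r by simp
  have E0: "card {w \<in> words N r. w 0 = Root} = card (strings ?m ?s)"
    using card_words_prefix[OF N r, of 0] assms by simp
  \<comment> \<open>Any of the \<open>r\<close> roots of a word may be the marked one; division by
    \<open>r\<close> gives the factor \<open>N / r\<close>.\<close>
  have "real r * real (B_sum N r) = real N * real (card (strings ?m ?s))"
    using root_double_count[OF N r] unfolding B_sum_eq[OF N r] E0 by (metis of_nat_mult)
  then have B: "real (B_sum N r) = real N / real r * real (card (strings ?m ?s))"
    using r by (simp add: field_simps)
  \<comment> \<open>For \<open>k > N - r\<close> there is no room for \<open>r\<close> roots beside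
    \<open>k\<close> frozen letters, so these terms vanish.\<close>
  have "(\<Sum>k = 1..<N. card (?E k)) = (\<Sum>k = 1..?m. card (strings (?m - k) ?s))"
  proof (rule sum.mono_neutral_cong_right)
    show "\<forall>k\<in>{1..<N} - {1..?m}. card (?E k) = 0"
      using assms card_words_prefix[OF N r] by auto
    show "card (?E k) = card (strings (?m - k) ?s)" if "k \<in> {1..?m}" for k
      using assms that card_words_prefix[OF N r, of k] by auto
  qed (use assms in auto)
  then have "A_sum N r = N * (card (strings ?m ?s) + 2 * (\<Sum>k = 1..?m. card (strings (?m - k) ?s)))"
    unfolding A_sum_eq[OF N r] leads_double_count[OF N r] card_leads[OF N r] E0 by (simp only:)
  then have "real (A_sum N r) =
      real N * (real (card (strings ?m ?s)) + 2 * (\<Sum>k = 1..?m. real (card (strings (?m - k) ?s))))"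
    by (simp only: of_nat_mult of_nat_add of_nat_sum of_nat_numeral)
  then show ?thesis
    using B coeff_A[of ?s ?m] coeff_B[of ?s ?m] unfolding Suc_s by (simp only:)
qed

end
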